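(* Let $T>0$. Suppose that for every $N\ge1$ an initial state $\nu^N$ of the (scaled) Non-Linear Markov Process $\nabla_\infty^N$ is given, i.e. a probability measure on $(\frac1N\mathbb{Z}_{\ge0})^5$, and that $\rho_{KROV}(\nu^N,\mu)\to0$ as $N\to\infty$ for a probability measure $\mu$ on $(\mathbb{R}^5)^+$. Let $\nu^N(t)$ be the evolution of $\nu^N$ under $\nabla_\infty^N$ and put $\tilde\nu^N(t)=\nu^N(Nt)$, $t\in[0,T]$. Then every KROV-limit point $\{\mu(t),t\in[0,T]\}$ of the sequence of trajectories $\{\tilde\nu^N(t),t\in[0,T]\}$, $N=1,2,\dots$ (that is, every family such that $\rho_{KROV}(\tilde\nu^{N_k}(t),\mu(t))\to0$ for all $t\in[0,T]$ along some subsequence $N_k\to\infty$) is a trajectory of the fluid model $\Delta_\infty$ on $[0,T]$ (with $\mu(0)=\mu$).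
   Context: Classes are $a\in\{O,A,B,AB,BA\}$; $(\mathbb{R}^5)^+=[0,\infty)^5$ with coordinates $(x_O,x_A,x_B,x_{AB},x_{BA})$; $e_a$ are the basis vectors. $\rho_{KROV}$ is the Kantorovich–Rubinstein (Wasserstein-1) distance for the metric $\sum_a|x_a-y_a|$, on probability measures with finite first moment. **Non-Linear Markov Process $\nabla_\infty^N$.** States are probability measures on $(\frac1N\mathbb{Z}_{\ge0})^5$; write $\nu_t(n)$, $n\in\mathbb{Z}_{\ge0}^5$, for the mass at $n/N$. Let $s_O(n)=3\cdot 1_{\{n_O>0\}}$, $s_{AB}(n)=2\cdot 1_{\{n_{AB}>0\}}$, $s_{BA}(n)=2\cdot 1_{\{n_{BA}>0\}}$, $s_A(n)=10\cdot 1_{\{n_A>0,\,n_{BA}=0\}}$, $s_B(n)=10\cdot 1_{\{n_B>0,\,n_{AB}=0\}}$. Put $\lambda_a(t)=\sum_n s_a(n)\nu_t(n)$ and $r_O=\lambda_{AB}+\lambda_{BA}$, $r_A=r_B=\lambda_O/2$, $r_{AB}=\lambda_A$, $r_{BA}=\lambda_B$. The evolution is the unique solution of $$\frac{d\nu_t(n)}{dt}=-\nu_t(n)\sum_a\big(r_a(t)+s_a(n)\big)+\sum_a\nu_t(n-e_a)r_a(t)+\sum_a\nu_t(n+e_a)s_a(n+e_a),$$ where $\nu_t(m)=0$ if $m$ has a negative coordinate. **Fluid dynamics with given inflow.** For $\gamma>0$, $x\ge0$ and a nondecreasing Lipschitz function $Y$ with $Y(0)=0$, put $W(\gamma,x,Y)(t)=V(t)+\max\{0,-\inf_{0\le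 s\le t}V(s)\}$, where $V(t)=x+Y(t)-\gamma t$. Given $\bar x(0)\in(\mathbb{R}^5)^+$ and $\bar Y=(Y_a)$ with nondecreasing Lipschitz components vanishing at $0$, the dynamics $\Delta(\bar Y)$ moves $\bar x(0)$ to $\bar x(t)$, where $x_O=W(3,x_O(0),Y_O)$, $x_{BA}=W(2,x_{BA}(0),Y_{BA})$, $x_A=W(10,\,5x_{BA}(0)+x_A(0),\,5Y_{BA}+Y_A)-5x_{BA}$, and symmetrically $x_{AB}=W(2,x_{AB}(0),Y_{AB})$, $x_B=W(10,\,5x_{AB}(0)+x_B(0),\,5Y_{AB}+Y_B)-5x_{AB}$. The net outflow is $\bar Z^{\bar x(0),\bar Y}(t)=\bar x(0)+\bar Y(t)-\bar x(t)$. **Fluid model $\Delta_\infty$.** A family $\mu(t)$ of probability measures on $(\mathbb{R}^5)^+$ is a trajectory of $\Delta_\infty$ if there is an inflow $\bar Y$ (nondecreasing Lipschitz, $\bar Y(0)=0$) such that, with $\mu_0=\mu(0)$, $Y_O(t)=\int(Z_{AB}^{\bar x,\bar Y}(t)+Z_{BA}^{\bar x,\bar Y}(t))\,d\mu_0(\bar x)$, $Y_A(t)=Y_B(t)=\frac12\int Z_O^{\bar x,\bar Y}(t)\,d\mu_0(\bar x)$, $Y_{AB}(t)=\int Z_A^{\bar x,\bar Y}(t)\,d\mu_0(\bar x)$, $Y_{BA}(t)=\int Z_B^{\bar x,\bar Y}(t)\,d\mu_0(\bar x)$, and $\mu(t)$ is the image of $\mu_0$ under the map $\bar x(0)\mapsto\bar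 x(t)$ of $\Delta(\bar Y)$. *)

theory Defs
  imports "HOL-Probability.Probability"
begin

datatype cls = K_O | K_A | K_B | K_AB | K_BA

lemma UNIV_cls: "UNIV = {K_O, K_A, K_B, K_AB, K_BA}"
  using cls.exhaust by auto

instance cls :: finite
  by standard (simp add: UNIV_cls)

type_synonym pt = "real ^ cls"


section \<open>Probability measures on the orthant and the KROV distance\<close>

text \<open>Measures on the orthant, or on a lattice inside it, are represented by Borel measures on the
  whole space that are concentrated there.\<close>

definition orthant :: "pt set" where
  "orthant = {x. \<forall>a. 0 \<le> x $ a}"

definition prob_on :: "pt set \<Rightarrow> pt measure \<Rightarrow> bool" where
  "prob_on S M \<longleftrightarrow> prob_space M \<and> sets M = sets borel \<and> (AE x in M. x \<in> S)"

definition l1_dist :: "pt \<Rightarrow> pt \<Rightarrow> real" where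
  "l1_dist x y = (\<Sum>a\<in>UNIV. \<bar>x $ a - y $ a\<bar>)"

definition finite_first_moment :: "pt measure \<Rightarrow> bool" where
  "finite_first_moment M \<longleftrightarrow> integrable M (\<lambda>x. l1_dist x 0)"

definition couplings :: "pt measure \<Rightarrow> pt measure \<Rightarrow> (pt \<times> pt) measure set" where
  "couplings M M' = {G. prob_space G \<and> sets G = sets (borel \<Otimes>\<^sub>M borel) \<and>
                        distr G borel fst = M \<and> distr G borel snd = M'}"

definition krov :: "pt measure \<Rightarrow> pt measure \<Rightarrow> ennreal" where
  "krov M M' = (INF G\<in>couplings M M'. \<integral>\<^sup>+ p. ennreal (l1_dist (fst p) (snd p)) \<partial>G)"

definition krov_limit_point ::
    "real \<Rightarrow> (nat \<Rightarrow> real \<Rightarrow> pt measure) \<Rightarrow> (real \<Rightarrow> pt measure) \<Rightarrow> bool" where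
  "krov_limit_point T \<xi> \<mu> \<longleftrightarrow>
     (\<forall>t\<in>{0..T}. prob_on orthant (\<mu> t) \<and> finite_first_moment (\<mu> t)) \<and>
     (\<exists>\<sigma>. strict_mono \<sigma> \<and> (\<forall>k. 1 \<le> \<sigma> k) \<and>
          (\<forall>t\<in>{0..T}. (\<lambda>k. krov (\<xi> (\<sigma> k) t) (\<mu> t)) \<longlonglongrightarrow> 0))"


section \<open>The non-linear Markov process\<close>

definition scaled :: "nat \<Rightarrow> (cls \<Rightarrow> nat) \<Rightarrow> pt" where
  "scaled N n = (\<chi> a. real (n a) / real N)"

definition lattice :: "nat \<Rightarrow> pt set" where
  "lattice N = range (scaled N)"

definition mass :: "nat \<Rightarrow> pt measure \<Rightarrow> (cls \<Rightarrow> nat) \<Rightarrow> real" where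
  "mass N M n = measure M {scaled N n}"

fun service :: "cls \<Rightarrow> (cls \<Rightarrow> nat) \<Rightarrow> real" where
  "service K_O n = (if n K_O > 0 then 3 else 0)"
| "service K_AB n = (if n K_AB > 0 then 2 else 0)"
| "service K_BA n = (if n K_BA > 0 then 2 else 0)"
| "service K_A n = (if n K_A > 0 \<and> n K_BA = 0 then 10 else 0)"
| "service K_B n = (if n K_B > 0 \<and> n K_AB = 0 then 10 else 0)"

definition outflow_rate :: "nat \<Rightarrow> pt measure \<Rightarrow> cls \<Rightarrow> real" where
  "outflow_rate N M a = (\<Sum>\<^sub>\<infinity>n. service a n * mass N M n)"

fun inflow_rate :: "nat \<Rightarrow> pt measure \<Rightarrow> cls \<Rightarrow> real" where
  "inflow_rate N M K_O = outflow_rate N M K_AB + outflow_rate N M K_BA"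
| "inflow_rate N M K_A = outflow_rate N M K_O / 2"
| "inflow_rate N M K_B = outflow_rate N M K_O / 2"
| "inflow_rate N M K_AB = outflow_rate N M K_A"
| "inflow_rate N M K_BA = outflow_rate N M K_B"

definition generator :: "nat \<Rightarrow> pt measure \<Rightarrow> (cls \<Rightarrow> nat) \<Rightarrow> real" where
  "generator N M n =
     - mass N M n * (\<Sum>a\<in>UNIV. inflow_rate N M a + service a n)
     + (\<Sum>a\<in>UNIV. if n a = 0 then 0 else mass N M (n(a := n a - 1)) * inflow_rate N M a)
     + (\<Sum>a\<in>UNIV. mass N M (n(a := n a + 1)) * service a (n(a := n a + 1)))"

definition nlmp_evolution :: "nat \<Rightarrow> (real \<Rightarrow> pt measure) \<Rightarrow> bool" where
  "nlmp_evolution N \<nu> \<longleftrightarrow>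
     (\<forall>t\<ge>0. prob_on (lattice N) (\<nu> t)) \<and>
     (\<forall>n. \<forall>t\<ge>0. ((\<lambda>s. mass N (\<nu> s) n) has_real_derivative generator N (\<nu> t) n)
                    (at t within {0..}))"


section \<open>The fluid model\<close>

definition workload :: "real \<Rightarrow> real \<Rightarrow> (real \<Rightarrow> real) \<Rightarrow> real \<Rightarrow> real" where
  "workload \<gamma> x Y t = (let V = (\<lambda>s. x + Y s - \<gamma> * s)
                         in V t + max 0 (- (INF s\<in>{0..t}. V s)))"

fun fluid_coord :: "(cls \<Rightarrow> real \<Rightarrow> real) \<Rightarrow> real \<Rightarrow> pt \<Rightarrow> cls \<Rightarrow> real" where
  "fluid_coord Y t x K_O = workload 3 (x $ K_O) (Y K_O) t"
| "fluid_coord Y t x K_BA = workload 2 (x $ K_BA) (Y K_BA) t"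
| "fluid_coord Y t x K_AB = workload 2 (x $ K_AB) (Y K_AB) t"
| "fluid_coord Y t x K_A =
     workload 10 (5 * x $ K_BA + x $ K_A) (\<lambda>s. 5 * Y K_BA s + Y K_A s) t
       - 5 * workload 2 (x $ K_BA) (Y K_BA) t"
| "fluid_coord Y t x K_B =
     workload 10 (5 * x $ K_AB + x $ K_B) (\<lambda>s. 5 * Y K_AB s + Y K_B s) t
       - 5 * workload 2 (x $ K_AB) (Y K_AB) t"

definition fluid_flow :: "(cls \<Rightarrow> real \<Rightarrow> real) \<Rightarrow> real \<Rightarrow> pt \<Rightarrow> pt" where
  "fluid_flow Y t x = (\<chi> a. fluid_coord Y t x a)"

definition net_outflow :: "(cls \<Rightarrow> real \<Rightarrow> real) \<Rightarrow> real \<Rightarrow> pt \<Rightarrow> cls \<Rightarrow> real" where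
  "net_outflow Y t x a = x $ a + Y a t - fluid_flow Y t x $ a"

definition inflow_on :: "real \<Rightarrow> (cls \<Rightarrow> real \<Rightarrow> real) \<Rightarrow> bool" where
  "inflow_on T Y \<longleftrightarrow>
     (\<forall>a. Y a 0 = 0 \<and> mono_on {0..T} (Y a) \<and> (\<exists>L. L-lipschitz_on {0..T} (Y a)))"

text \<open>For an inflow \<open>Y\<close> the map \<^term>\<open>fluid_flow Y t\<close> is continuous and
  \<^term>\<open>net_outflow Y t\<close> is bounded, so the push-forward and the integrals below are not
  affected by the default values for non-measurable or non-integrable functions.\<close>

definition fluid_trajectory :: "real \<Rightarrow> (real \<Rightarrow> pt measure) \<Rightarrow> bool" where
  "fluid_trajectory T \<mu> \<longleftrightarrow>
     (\<forall>t\<in>{0..T}. prob_on orthant (\<mu> t)) \<and>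
     (\<exists>Y. inflow_on T Y \<and>
        (\<forall>t\<in>{0..T}.
           Y K_O t = (\<integral>x. net_outflow Y t x K_AB + net_outflow Y t x K_BA \<partial>\<mu> 0) \<and>
           Y K_A t = (\<integral>x. net_outflow Y t x K_O \<partial>\<mu> 0) / 2 \<and>
           Y K_B t = (\<integral>x. net_outflow Y t x K_O \<partial>\<mu> 0) / 2 \<and>
           Y K_AB t = (\<integral>x. net_outflow Y t x K_A \<partial>\<mu> 0) \<and>
           Y K_BA t = (\<integral>x. net_outflow Y t x K_B \<partial>\<mu> 0) \<and>
           \<mu> t = distr (\<mu> 0) borel (fluid_flow Y t)))"

end

theory Submission
  imports Defs "HOL-Complex_Analysis.Great_Picard"
begin

text \<open>In suitable linear coordinates (five queues) the fluid dynamics is a family of independent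
  one-dimensional reflected paths, and each queue of the particle system is served at full speed
  until it is empty. For a reflected fluid path \<open>w\<close> with the same inflow, the generator applied to
  \<open>(q - w)\<^sup>2\<close> is therefore at most of order \<open>1/N\<close>, since both reflections decrease the distance.

  The joint law of the process and its initial state is avoided by duality: the inf-convolution
  \<open>g\<^sub>s(n) = min 1 (inf\<^sub>x (\<phi>(F\<^sub>t x) + K |q(n/N) - q(F\<^sub>s x)|\<^sup>2))\<close> along the fluid flow \<open>F\<close> is almost a
  supersolution of the backward equation, so its expectation increases by at most \<open>O(K/N)\<close>. As
  \<open>g\<^sub>0 \<le> \<phi> \<circ> F\<^sub>t\<close> and \<open>g\<^sub>t \<ge> \<phi> - O(1/K)\<close>, the law at time \<open>t\<close> is asymptotically the image of the
  initial law under \<open>F\<^sub>t\<close>. The inflows are uniformly Lipschitz, so a further subsequence converges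
  uniformly, and the balance of first moments identifies the outflows of the limit.\<close>

section \<open>Reflected paths and queues\<close>

text \<open>The forward equation constrains only one-time laws, and the service rates jump at the
  boundary, so convergence of generators on smooth functions is not at hand either. For a fixed
  solution, however, the inflow rates are known functions of time. Every estimate along the process
  therefore concerns a linear, time-inhomogeneous chain and the fluid driven by the same arrivals;
  the nonlinearity returns only when arrivals are equated with departures in the limit. The order
  \<open>1/N\<close> is a variance: jumps of size \<open>1/N\<close> at bounded rates contribute
  order \<open>1/N^2\<close> per unit of process time, over a time \<open>N * t\<close>. The penalty
  \<open>K\<close> stays fixed while \<open>N\<close> tends to infinity and is sent to infinity
  afterwards, so no relation between the two is imposed. A one-sided bound on expectations suffices,
  because \<open>1 - \<phi>\<close> is as good a test function as \<open>\<phi>\<close>. Bounded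
  test functions identify the law; the KROV distance is needed for the unbounded coordinates, whose
  means carry the departures.\<close>

lemma lipschitz_bdd_below:
  fixes Y :: "real \<Rightarrow> real"
  assumes "L-lipschitz_on {0..T} Y" "t \<le> T"
  shows "bdd_below (Y ` {0..t})"
proof (rule bdd_belowI2)
  fix s assume s: "s \<in> {0..t}"
  have L: "0 \<le> L" using assms(1) by (simp add: lipschitz_on_def)
  have "\<bar>Y s - Y 0\<bar> \<le> L * \<bar>s - 0\<bar>"
    using lipschitz_onD[OF assms(1), of s 0] s assms(2) by (simp add: dist_real_def)
  moreover have "L * \<bar>s - 0\<bar> \<le> L * T" using s assms(2) L by (auto intro!: mult_left_mono)
  ultimately show "Y 0 - L * T \<le> Y s" by linarith
qed

lemma bdd_below_affine:
  fixes Y :: "real \<Rightarrow> real"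
  assumes "bdd_below (Y ` {0..t})" "0 \<le> \<gamma>"
  shows "bdd_below ((\<lambda>s. x + Y s - \<gamma> * s) ` {0..t})"
proof -
  obtain m where m: "\<And>s. s \<in> {0..t} \<Longrightarrow> m \<le> Y s"
    using assms(1) unfolding bdd_below_def by blast
  show ?thesis
  proof (rule bdd_belowI2)
    fix s assume s: "s \<in> {0..t}"
    have "\<gamma> * s \<le> \<gamma> * t" using s assms(2) by (auto intro: mult_left_mono)
    then show "x + m - \<gamma> * t \<le> x + Y s - \<gamma> * s" using m[OF s] by linarith
  qed
qed

lemma workload_nonneg:
  assumes "bdd_below (Y ` {0..t})" "0 \<le> \<gamma>" "0 \<le> t"
  shows "0 \<le> workload \<gamma> x Y t"
proof -
  have "(INF s\<in>{0..t}. x + Y s - \<gamma> * s) \<le> x + Y t - \<gamma> * t"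
    using assms by (intro cINF_lower bdd_below_affine) auto
  then show ?thesis unfolding workload_def Let_def by linarith
qed

lemma workload_0: "0 \<le> x \<Longrightarrow> Y 0 = 0 \<Longrightarrow> workload \<gamma> x Y 0 = x"
  by (simp add: workload_def)

text \<open>One \<open>d\<close> is the change of the free path, the other the change of its running
  infimum.\<close>

lemma workload_diff:
  assumes Y: "bdd_below (Y ` {0..t})" and Y': "bdd_below (Y' ` {0..t})" and "0 \<le> \<gamma>" "0 \<le> t"
    and d: "\<And>s. s \<in> {0..t} \<Longrightarrow> \<bar>(x + Y s) - (x' + Y' s)\<bar> \<le> d"
  shows "\<bar>workload \<gamma> x Y t - workload \<gamma> x' Y' t\<bar> \<le> 2 * d"
proof -
  have aux: "(INF s\<in>{0..t}. x + Y s - \<gamma> * s) - d \<le> (INF s\<in>{0..t}. x' + Y' s - \<gamma> * s)"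
    if "bdd_below (Y ` {0..t})" and d: "\<And>s. s \<in> {0..t} \<Longrightarrow> \<bar>(x + Y s) - (x' + Y' s)\<bar> \<le> d"
    for x x' Y Y'
  proof (rule cINF_greatest)
    fix s assume s: "s \<in> {0..t}"
    have "(INF s\<in>{0..t}. x + Y s - \<gamma> * s) \<le> x + Y s - \<gamma> * s"
      using s by (intro cINF_lower bdd_below_affine that \<open>0 \<le> \<gamma>\<close>)
    then show "(INF s\<in>{0..t}. x + Y s - \<gamma> * s) - d \<le> x' + Y' s - \<gamma> * s"
      using d[OF s] by linarith
  qed (use \<open>0 \<le> t\<close> in auto)
  have d': "\<And>s. s \<in> {0..t} \<Longrightarrow> \<bar>(x' + Y' s) - (x + Y s)\<bar> \<le> d"
    using d by (simp add: abs_minus_commute)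
  show ?thesis
    using aux[OF Y d] aux[OF Y' d'] d[of t] \<open>0 \<le> t\<close>
    unfolding workload_def Let_def by auto
qed

text \<open>The reflection term \<open>l\<close> grows only where the workload vanishes, so over a short interval
  its product with the final workload is of second order.\<close>

lemma workload_step:
  assumes lip: "L-lipschitz_on {0..T} Y" and "0 \<le> \<gamma>" "0 \<le> s" "s \<le> t" "t \<le> T"
  obtains l where "0 \<le> l"
    "workload \<gamma> x Y t - workload \<gamma> x Y s = Y t - Y s - \<gamma> * (t - s) + l"
    "l * workload \<gamma> x Y t \<le> (L + \<gamma>)\<^sup>2 * (t - s)\<^sup>2"
proof -
  define V where "V = (\<lambda>s. x + Y s - \<gamma> * s)"
  define I where "I = (\<lambda>t. INF s\<in>{0..t}. V s)"
  define m where "m = (\<lambda>t. max 0 (- I t))"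
  \<comment> \<open>\<open>e\<close> bounds the oscillation of the free path \<open>V\<close>
    between \<open>s\<close> and \<open>t\<close>.\<close>
  define e where "e = (L + \<gamma>) * (t - s)"
  have L: "0 \<le> L" using lip by (simp add: lipschitz_on_def)
  have e: "0 \<le> e" unfolding e_def using L assms by simp
  have w: "workload \<gamma> x Y u = V u + m u" for u
    by (simp add: workload_def V_def I_def m_def Let_def)
  have bdd: "bdd_below (V ` {0..u})" if "u \<le> T" for u
    unfolding V_def using lipschitz_bdd_below[OF lip that] \<open>0 \<le> \<gamma>\<close> by (rule bdd_below_affine)
  have low: "I u \<le> V v" if "u \<le> T" "v \<in> {0..u}" for u v
    unfolding I_def using bdd[OF that(1)] that(2) by (rule cINF_lower)
  have Vd: "\<bar>V u - V v\<bar> \<le> e" if "u \<in> {s..t}" "v \<in> {s..t}" for u v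
  proof -
    have "\<bar>Y u - Y v\<bar> \<le> L * \<bar>u - v\<bar>"
      using lipschitz_onD[OF lip, of u v] that assms by (simp add: dist_real_def)
    moreover have "\<bar>\<gamma> * u - \<gamma> * v\<bar> = \<gamma> * \<bar>u - v\<bar>"
      using \<open>0 \<le> \<gamma>\<close> by (metis abs_mult abs_of_nonneg right_diff_distrib)
    moreover have "\<bar>V u - V v\<bar> \<le> \<bar>Y u - Y v\<bar> + \<bar>\<gamma> * u - \<gamma> * v\<bar>" unfolding V_def by linarith
    moreover have "(L + \<gamma>) * \<bar>u - v\<bar> \<le> e"
      unfolding e_def using that L \<open>0 \<le> \<gamma>\<close> by (intro mult_left_mono) auto
    ultimately show ?thesis by (simp add: distrib_right)
  qed
  have anti: "I t \<le> I s"
    unfolding I_def using bdd[OF \<open>t \<le> T\<close>] assms by (intro cINF_superset_mono) auto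
  \<comment> \<open>A running infimum that drops after \<open>s\<close> is approached between
    \<open>s\<close> and \<open>t\<close>, where \<open>V\<close> stays within \<open>e\<close> of
    \<open>V u\<close>. While the reflection term grows, \<open>u = t\<close> then puts the final
    workload below \<open>e\<close>, and \<open>u = s\<close> bounds the growth itself by
    \<open>e\<close>; the product is the claimed square.\<close>
  have split: "min (I s) (V u - e) \<le> I t" if "u \<in> {s..t}" for u
  proof -
    have "min (I s) (V u - e) \<le> V v" if v: "v \<in> {0..t}" for v
    proof (cases "v \<le> s")
      case True
      then show ?thesis using low[of s v] v assms by auto
    next
      case False
      then show ?thesis using Vd[of u v] v \<open>u \<in> {s..t}\<close> by auto
    qed
    then show ?thesis unfolding I_def[of] using assms by (intro cINF_greatest) (auto simp: I_def)
  qed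
  define l where "l = m t - m s"
  have l0: "0 \<le> l" unfolding l_def m_def using anti by auto
  define w' where w': "w' = V t + m t"
  have "l * w' \<le> e\<^sup>2"
  proof (cases "l = 0")
    case False
    then have It: "I t < I s" "m t = - I t" using anti unfolding l_def m_def by auto
    have 1: "V t - e \<le> I t" using split[of t] It assms by auto
    have "I s - e \<le> I t" using split[of s] low[of s s] e assms by auto
    then have "l \<le> e" unfolding l_def m_def using e by auto
    moreover have "w' \<le> e" using 1 It w' by simp
    moreover have "0 \<le> w'" using low[of t t] assms It w' by auto
    ultimately show ?thesis using l0 by (auto simp: power2_eq_square intro: mult_mono)
  qed simp
  moreover have "e\<^sup>2 = (L + \<gamma>)\<^sup>2 * (t - s)\<^sup>2" by (simp add: e_def power_mult_distrib)
  moreover have "w' = workload \<gamma> x Y t" by (simp add: w w')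
  moreover have "workload \<gamma> x Y t - workload \<gamma> x Y s = Y t - Y s - \<gamma> * (t - s) + l"
    by (simp add: w l_def V_def algebra_simps)
  ultimately show ?thesis
    using l0 that[of l] by metis
qed

section \<open>Linear queue coordinates of the priority network\<close>

lemma sum_cls: "(\<Sum>a\<in>UNIV. f a) = f K_O + f K_A + f K_B + f K_AB + f K_BA"
  for f :: "cls \<Rightarrow> 'a::comm_monoid_add"
  by (simp add: UNIV_cls add.assoc)

lemma CARD_cls: "CARD(cls) = 5"
  by (simp add: UNIV_cls)

text \<open>Class \<open>K_BA\<close>, served at rate 2, has priority over \<open>K_A\<close>, served at rate 10. With weight 5 for
  \<open>K_BA\<close>, their common queue decreases at rate 10 whichever of the two is served; it is indexed
  by \<open>K_A\<close>. The same holds for \<open>K_AB\<close> and \<open>K_B\<close>.\<close>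

definition queue_weight :: "cls \<Rightarrow> cls \<Rightarrow> real" where
  "queue_weight i a = (if i = a then 1
     else if i = K_A \<and> a = K_BA \<or> i = K_B \<and> a = K_AB then 5 else 0)"

definition queue :: "cls \<Rightarrow> (cls \<Rightarrow> real) \<Rightarrow> real" where
  "queue i x = (\<Sum>a\<in>UNIV. queue_weight i a * x a)"

fun queue_speed :: "cls \<Rightarrow> real" where
  "queue_speed K_O = 3"
| "queue_speed K_A = 10"
| "queue_speed K_B = 10"
| "queue_speed K_AB = 2"
| "queue_speed K_BA = 2"

lemma queue_simps:
  "queue K_O x = x K_O" "queue K_A x = 5 * x K_BA + x K_A" "queue K_B x = 5 * x K_AB + x K_B"
  "queue K_AB x = x K_AB" "queue K_BA x = x K_BA"
  by (simp_all add: queue_def queue_weight_def sum_cls)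

lemma queue_weight_nonneg: "0 \<le> queue_weight i a"
  by (simp add: queue_weight_def)

lemma queue_weight_le: "queue_weight i a \<le> 5"
  by (simp add: queue_weight_def)

lemma queue_speed_nonneg: "0 \<le> queue_speed i"
  by (cases i) auto

lemma queue_speed_le: "queue_speed i \<le> 10"
  by (cases i) auto

lemma service_nonneg: "0 \<le> service a n"
  by (cases a) auto

lemma service_le: "service a n \<le> 10"
  by (cases a) auto

lemma service_eq_0: "n a = 0 \<Longrightarrow> service a n = 0"
  by (cases a) auto

text \<open>Blocking by the priority class has disappeared: the state enters only through the queue
  itself being empty, exactly as in a one-dimensional reflected path.\<close>

lemma queue_service:
  "(\<Sum>a\<in>UNIV. queue_weight i a * service a n) =
    (if queue i (\<lambda>a. real (n a)) = 0 then 0 else queue_speed i)"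
  by (cases i) (auto simp: queue_weight_def sum_cls queue_simps)

lemma queue_fluid_flow:
  "queue i (($) (fluid_flow Y t x)) =
    workload (queue_speed i) (queue i (($) x)) (\<lambda>s. queue i (\<lambda>a. Y a s)) t"
  by (cases i) (auto simp: queue_simps fluid_flow_def)

lemma abs_queue_le: "\<bar>queue i x\<bar> \<le> 5 * (\<Sum>a\<in>UNIV. \<bar>x a\<bar>)"
  by (cases i) (auto simp: queue_simps sum_cls)

text \<open>The change of coordinates is triangular. A priority class is counted once for itself and
  five times in recovering the lower class from the common queue, hence the 6.\<close>

lemma sum_abs_le_queue: "(\<Sum>a\<in>UNIV. \<bar>x a\<bar>) \<le> 6 * (\<Sum>i\<in>UNIV. \<bar>queue i x\<bar>)"
proof -
  have "\<bar>x K_A\<bar> \<le> \<bar>5 * x K_BA + x K_A\<bar> + 5 * \<bar>x K_BA\<bar>"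
    "\<bar>x K_B\<bar> \<le> \<bar>5 * x K_AB + x K_B\<bar> + 5 * \<bar>x K_AB\<bar>" by linarith+
  then show ?thesis
    using abs_ge_zero[of "5 * x K_BA + x K_A"] abs_ge_zero[of "5 * x K_AB + x K_B"]
      abs_ge_zero[of "x K_O"]
    unfolding queue_simps sum_cls distrib_left by linarith
qed

lemma queue_diff: "queue i (\<lambda>a. x a - y a) = queue i x - queue i y"
  by (simp add: queue_def sum_subtractf right_diff_distrib)

lemma l1_dist_le_queue: "l1_dist x y \<le> 6 * (\<Sum>i\<in>UNIV. \<bar>queue i (($) x) - queue i (($) y)\<bar>)"
  using sum_abs_le_queue[of "\<lambda>a. x $ a - y $ a"] by (simp add: l1_dist_def queue_diff)

lemma queue_diff_le_l1_dist: "\<bar>queue i (($) x) - queue i (($) y)\<bar> \<le> 5 * l1_dist x y"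
  using abs_queue_le[of i "\<lambda>a. x $ a - y $ a"] by (simp add: l1_dist_def queue_diff)

text \<open>The constant 300 is 6 for leaving the queue coordinates, times 5 queues, times 2 for the
  reflection, times 5 for the largest weight. Equal inflows give the Lipschitz property in the
  starting point, equal starting points the stability under convergence of the inflows.\<close>

lemma fluid_flow_diff:
  assumes Y: "\<And>a. bdd_below (Y a ` {0..t})" and Y': "\<And>a. bdd_below (Y' a ` {0..t})" and "0 \<le> t"
    and d: "\<And>a s. s \<in> {0..t} \<Longrightarrow> \<bar>Y a s - Y' a s\<bar> \<le> d"
  shows "l1_dist (fluid_flow Y t x) (fluid_flow Y' t x') \<le> 300 * (l1_dist x x' + 5 * d)"
proof -
  have bdd: "bdd_below ((\<lambda>s. queue i (\<lambda>a. Y a s)) ` {0..t})"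
    if Y: "\<And>a. bdd_below (Y a ` {0..t})" for i and Y :: "cls \<Rightarrow> real \<Rightarrow> real"
  proof -
    obtain b where b: "\<And>a s. s \<in> {0..t} \<Longrightarrow> b a \<le> Y a s"
      using Y unfolding bdd_below_def by (metis image_eqI)
    show ?thesis
      by (rule bdd_belowI2[of _ "queue i b"])
        (auto simp: queue_def intro!: sum_mono mult_left_mono queue_weight_nonneg b)
  qed
  have "\<bar>queue i (($) (fluid_flow Y t x)) - queue i (($) (fluid_flow Y' t x'))\<bar>
      \<le> 2 * (5 * (l1_dist x x' + 5 * d))" for i
    unfolding queue_fluid_flow
  proof (rule workload_diff[OF bdd[OF Y] bdd[OF Y'] queue_speed_nonneg \<open>0 \<le> t\<close>])
    fix s assume s: "s \<in> {0..t}"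
    have "\<bar>queue i (\<lambda>a. Y a s - Y' a s)\<bar> \<le> 5 * (\<Sum>a\<in>(UNIV::cls set). d)"
      using d[OF s] by (intro order_trans[OF abs_queue_le] mult_left_mono sum_mono) auto
    moreover have "(\<Sum>a\<in>(UNIV::cls set). d) = 5 * d" by (simp add: CARD_cls)
    ultimately show "\<bar>queue i (($) x) + queue i (\<lambda>a. Y a s)
        - (queue i (($) x') + queue i (\<lambda>a. Y' a s))\<bar> \<le> 5 * (l1_dist x x' + 5 * d)"
      using queue_diff_le_l1_dist[of i x x'] unfolding queue_diff distrib_left by linarith
  qed
  then have "(\<Sum>i\<in>UNIV. \<bar>queue i (($) (fluid_flow Y t x)) - queue i (($) (fluid_flow Y' t x'))\<bar>)
      \<le> (\<Sum>i\<in>(UNIV::cls set). 2 * (5 * (l1_dist x x' + 5 * d)))"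
    by (intro sum_mono)
  then show ?thesis
    using l1_dist_le_queue[of "fluid_flow Y t x" "fluid_flow Y' t x'"] by (simp add: CARD_cls)
qed

lemma fluid_flow_0:
  assumes "\<And>a. Y a 0 = 0" "x \<in> orthant"
  shows "fluid_flow Y 0 x = x"
proof -
  have "fluid_coord Y 0 x a = x $ a" for a
    using assms by (cases a) (auto simp: orthant_def workload_0)
  then show ?thesis by (simp add: fluid_flow_def vec_eq_iff)
qed

section \<open>The Markov process with bounded observables\<close>

abbreviation arrive :: "cls \<Rightarrow> (cls \<Rightarrow> nat) \<Rightarrow> cls \<Rightarrow> nat" where
  "arrive a n \<equiv> n(a := n a + 1)"

abbreviation depart :: "cls \<Rightarrow> (cls \<Rightarrow> nat) \<Rightarrow> cls \<Rightarrow> nat" where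
  "depart a n \<equiv> n(a := n a - 1)"

text \<open>With \<open>h = 1\<close> and inflow rates \<open>r\<close> this is the generator; with the arrivals \<open>r\<close> during a time
  interval of length \<open>h\<close> it is the increment of an Euler step.\<close>

definition drift :: "(cls \<Rightarrow> real) \<Rightarrow> real \<Rightarrow> ((cls \<Rightarrow> nat) \<Rightarrow> real) \<Rightarrow> (cls \<Rightarrow> nat) \<Rightarrow> real" where
  "drift r h f n = (\<Sum>a\<in>UNIV. r a * (f (arrive a n) - f n))
     + h * (\<Sum>a\<in>UNIV. service a n * (f (depart a n) - f n))"

definition outflow :: "(cls \<Rightarrow> nat) pmf \<Rightarrow> cls \<Rightarrow> real" where
  "outflow p a = measure_pmf.expectation p (service a)"

fun inflow :: "(cls \<Rightarrow> nat) pmf \<Rightarrow> cls \<Rightarrow> real" where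
  "inflow p K_O = outflow p K_AB + outflow p K_BA"
| "inflow p K_A = outflow p K_O / 2"
| "inflow p K_B = outflow p K_O / 2"
| "inflow p K_AB = outflow p K_A"
| "inflow p K_BA = outflow p K_B"

lemma integrable_pmf_bounded:
  fixes f :: "'a \<Rightarrow> real"
  assumes "\<And>n. \<bar>f n\<bar> \<le> B"
  shows "integrable (measure_pmf p) f"
  using assms by (intro measure_pmf.integrable_const_bound[of _ B]) auto

lemma abs_expectation_le:
  fixes f :: "'a \<Rightarrow> real"
  assumes "\<And>n. \<bar>f n\<bar> \<le> B"
  shows "\<bar>measure_pmf.expectation p f\<bar> \<le> B"
proof -
  have "\<bar>measure_pmf.expectation p f\<bar> \<le> measure_pmf.expectation p (\<lambda>n. \<bar>f n\<bar>)"
    by (rule integral_abs_bound)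
  also have "\<dots> \<le> measure_pmf.expectation p (\<lambda>n. B)"
    using assms order_trans[OF abs_ge_zero assms]
    by (intro integral_mono integrable_pmf_bounded[of _ B]) auto
  finally show ?thesis by simp
qed

lemma expectation_mono_bounded:
  fixes f g :: "'a \<Rightarrow> real"
  assumes "\<And>n. \<bar>f n\<bar> \<le> B" "\<And>n. \<bar>g n\<bar> \<le> C" "\<And>n. f n \<le> g n"
  shows "measure_pmf.expectation p f \<le> measure_pmf.expectation p g"
  using assms by (intro integral_mono integrable_pmf_bounded[of f B] integrable_pmf_bounded[of g C])

lemma integrable_service: "integrable (measure_pmf p) (service a)"
  using service_nonneg service_le by (intro integrable_pmf_bounded[of _ 10]) auto

lemma outflow_nonneg: "0 \<le> outflow p a"
  unfolding outflow_def by (intro Bochner_Integration.integral_nonneg service_nonneg)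

lemma outflow_le: "outflow p a \<le> 10"
  using abs_expectation_le[of "service a" 10 p] service_nonneg service_le
  by (simp add: outflow_def)

lemma inflow_nonneg: "0 \<le> inflow p a"
  by (cases a) (auto simp: outflow_nonneg)

lemma inflow_le: "inflow p a \<le> 20"
  using outflow_le[of p K_A] outflow_le[of p K_B] outflow_le[of p K_O] outflow_le[of p K_AB]
    outflow_le[of p K_BA] by (cases a) auto

text \<open>Each of the five classes changes \<open>f\<close> by at most \<open>2 * B\<close>, with
  weight at most \<open>c\<close> for an arrival and \<open>10 * h\<close> for a departure. For the
  generator \<open>c\<close> is 20 and \<open>h\<close> is 1, which is the origin of the recurring
  300.\<close>

lemma abs_drift_le:
  assumes f: "\<And>n. \<bar>f n\<bar> \<le> B" and r: "\<And>a. \<bar>r a\<bar> \<le> c" and "0 \<le> h"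
  shows "\<bar>drift r h f n\<bar> \<le> 10 * B * (c + 10 * h)"
proof -
  have d: "\<bar>f m - f n\<bar> \<le> 2 * B" for m using f[of m] f[of n] by linarith
  have B: "0 \<le> B" using f[of n] by linarith
  have "\<bar>\<Sum>a\<in>UNIV. r a * (f (arrive a n) - f n)\<bar> \<le> (\<Sum>a\<in>(UNIV::cls set). c * (2 * B))"
    using d r B by (intro order_trans[OF sum_abs] sum_mono) (auto simp: abs_mult intro!: mult_mono
        intro: order_trans[OF abs_ge_zero])
  moreover have "\<bar>\<Sum>a\<in>UNIV. service a n * (f (depart a n) - f n)\<bar>
      \<le> (\<Sum>a\<in>(UNIV::cls set). 10 * (2 * B))"
  proof (intro order_trans[OF sum_abs] sum_mono)
    fix a
    have "service a n * \<bar>f (depart a n) - f n\<bar> \<le> 10 * (2 * B)"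
      by (rule mult_mono[OF service_le d]) auto
    then show "\<bar>service a n * (f (depart a n) - f n)\<bar> \<le> 10 * (2 * B)"
      using service_nonneg by (simp add: abs_mult)
  qed
  then have "\<bar>h * (\<Sum>a\<in>UNIV. service a n * (f (depart a n) - f n))\<bar>
      \<le> h * (\<Sum>a\<in>(UNIV::cls set). 10 * (2 * B))"
    using \<open>0 \<le> h\<close> by (simp only: abs_mult abs_of_nonneg mult_left_mono)
  ultimately show ?thesis
    unfolding drift_def by (simp add: CARD_cls algebra_simps)
qed

lemma drift_sum:
  "drift r h (\<lambda>n. \<Sum>m\<in>S. f m n) n = (\<Sum>m\<in>S. drift r h (f m) n)"
  unfolding drift_def sum_distrib_left
  by (simp add: sum.distrib sum_subtractf[symmetric] sum_distrib_left sum.swap[of _ UNIV S])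

lemma drift_cmult: "drift r h (\<lambda>n. c * f n) n = c * drift r h f n"
  unfolding drift_def by (simp add: distrib_left sum_distrib_left algebra_simps)

text \<open>This is the forward equation read backwards: jumps out of \<open>m\<close>, and jumps
  into \<open>m\<close> by an arrival or a departure. Subtraction on naturals makes
  \<open>depart a\<close> the identity when class \<open>a\<close> is empty; fact \<open>2\<close>
  treats that case separately, where the zero service rate removes the term.\<close>

lemma drift_indicator:
  "drift r 1 (indicator {m}) n =
     - (\<Sum>a\<in>UNIV. r a + service a m) * indicator {m} n
     + (\<Sum>a\<in>UNIV. (if m a = 0 then 0 else r a) * indicator {depart a m} n)
     + (\<Sum>a\<in>UNIV. service a (arrive a m) * indicator {arrive a m} n)"
proof -
  have 1: "r a * indicator {m} (arrive a n) = (if m a = 0 then 0 else r a) * indicator {depart a m} n" for a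
    by (auto simp: indicator_def fun_eq_iff)
  have 2: "service a n * indicator {m} (depart a n)
      = service a (arrive a m) * indicator {arrive a m} n" for a
  proof (cases "n a = 0")
    case True
    then have "n \<noteq> arrive a m" by (auto simp: fun_eq_iff)
    then show ?thesis using service_eq_0[of n a, OF True] by simp
  next
    case False
    then have "depart a n = m \<longleftrightarrow> n = arrive a m" by (auto simp: fun_eq_iff)
    then show ?thesis by (auto simp: indicator_def)
  qed
  have 3: "service a n * indicator {m} n = service a m * indicator {m} n" for a
    by (auto simp: indicator_def)
  show ?thesis
    unfolding drift_def right_diff_distrib 1 2 3 sum_subtractf sum.distrib
    by (simp only: sum_distrib_right[symmetric] mult_1) algebra
qed

lemma expectation_drift_indicator:
  "measure_pmf.expectation p (drift r 1 (indicator {m})) =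
     - pmf p m * (\<Sum>a\<in>UNIV. r a + service a m)
     + (\<Sum>a\<in>UNIV. if m a = 0 then 0 else pmf p (depart a m) * r a)
     + (\<Sum>a\<in>UNIV. pmf p (arrive a m) * service a (arrive a m))"
proof -
  define I :: "(cls \<Rightarrow> nat) \<Rightarrow> (cls \<Rightarrow> nat) \<Rightarrow> real" where "I k n = indicator {k} n" for k n
  have int: "integrable (measure_pmf p) (I k)" for k
    by (rule integrable_pmf_bounded[of _ 1]) (auto simp: I_def indicator_def)
  have E: "measure_pmf.expectation p (I k) = pmf p k" for k
    by (simp add: I_def[abs_def] measure_pmf_single)
  have "drift r 1 (indicator {m}) = (\<lambda>n. - (\<Sum>a\<in>UNIV. r a + service a m) * I m n
     + (\<Sum>a\<in>UNIV. (if m a = 0 then 0 else r a) * I (depart a m) n)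
     + (\<Sum>a\<in>UNIV. service a (arrive a m) * I (arrive a m) n))"
    by (rule ext) (simp only: drift_indicator I_def)
  then have "measure_pmf.expectation p (drift r 1 (indicator {m})) =
     - (\<Sum>a\<in>UNIV. r a + service a m) * pmf p m
     + (\<Sum>a\<in>UNIV. (if m a = 0 then 0 else r a) * pmf p (depart a m))
     + (\<Sum>a\<in>UNIV. service a (arrive a m) * pmf p (arrive a m))"
    by (simp add: int E)
  moreover have "(if m a = 0 then 0 else r a) * x = (if m a = 0 then 0 else x * r a)" for a x
    by simp
  ultimately show ?thesis by (simp add: mult.commute cong: if_cong)
qed

text \<open>For a short step, \<open>f + drift r h f\<close> is an average of values of
  \<open>f\<close> with nonnegative coefficients; 50 bounds the total service rate of five classes.
  This discrete maximum principle allows an infimum of functions to be propagated without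
  differentiating it.\<close>

lemma drift_mono:
  assumes "\<And>m. f m \<le> g m" "\<And>a. 0 \<le> r a" "0 \<le> h" "(\<Sum>a\<in>UNIV. r a) + 50 * h \<le> 1"
  shows "f n + drift r h f n \<le> g n + drift r h g n"
proof -
  define c where "c = (\<Sum>a\<in>UNIV. r a) + h * (\<Sum>a\<in>UNIV. service a n)"
  have eq: "u n + drift r h u n = (1 - c) * u n + (\<Sum>a\<in>UNIV. r a * u (arrive a n))
      + h * (\<Sum>a\<in>UNIV. service a n * u (depart a n))" for u :: "(cls \<Rightarrow> nat) \<Rightarrow> real"
    unfolding drift_def c_def
    by (simp add: sum_subtractf right_diff_distrib sum_distrib_left[symmetric]
        sum_distrib_right[symmetric] algebra_simps)
  have "(\<Sum>a\<in>UNIV. service a n) \<le> (\<Sum>a\<in>(UNIV::cls set). 10)" by (intro sum_mono service_le)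
  then have "(\<Sum>a\<in>UNIV. service a n) \<le> 50" by (simp add: CARD_cls)
  then have "h * (\<Sum>a\<in>UNIV. service a n) \<le> h * 50" using assms(3) by (intro mult_left_mono)
  then have "0 \<le> 1 - c" using assms(4) unfolding c_def by linarith
  then show ?thesis unfolding eq using assms
    by (intro add_mono mult_left_mono sum_mono service_nonneg) auto
qed

text \<open>Only the forward equation for a family of laws on counts is retained; there are no
  sample paths and no transition kernel. The rates are computed from \<open>P\<close>
  itself.\<close>

locale network =
  fixes P :: "real \<Rightarrow> (cls \<Rightarrow> nat) pmf"
  assumes forward: "0 \<le> t \<Longrightarrow> ((\<lambda>s. pmf (P s) n) has_real_derivative
     - pmf (P t) n * (\<Sum>a\<in>UNIV. inflow (P t) a + service a n)
     + (\<Sum>a\<in>UNIV. if n a = 0 then 0 else pmf (P t) (depart a n) * inflow (P t) a)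
     + (\<Sum>a\<in>UNIV. pmf (P t) (arrive a n) * service a (arrive a n))) (at t within {0..})"
begin

abbreviation gen :: "real \<Rightarrow> ((cls \<Rightarrow> nat) \<Rightarrow> real) \<Rightarrow> (cls \<Rightarrow> nat) \<Rightarrow> real" where
  "gen t \<equiv> drift (inflow (P t)) 1"

abbreviation E :: "real \<Rightarrow> ((cls \<Rightarrow> nat) \<Rightarrow> real) \<Rightarrow> real" where
  "E t \<equiv> measure_pmf.expectation (P t)"

section \<open>Dynkin's formula for bounded functions\<close>

lemma abs_gen_le:
  assumes "\<And>n. \<bar>f n\<bar> \<le> B"
  shows "\<bar>gen t f n\<bar> \<le> 300 * B"
  using abs_drift_le[of f B "inflow (P t)" 20 1 n] assms inflow_nonneg inflow_le by simp

lemma dynkin_indicator: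
  assumes "0 \<le> s" "s \<le> t"
  shows "((\<lambda>u. E u (gen u (indicator {m}))) has_integral
           (E t (indicator {m}) - E s (indicator {m}))) {s..t}"
proof -
  have "((\<lambda>u. E u (gen u (indicator {m}))) has_integral (pmf (P t) m - pmf (P s) m)) {s..t}"
  proof (rule fundamental_theorem_of_calculus[OF assms(2)])
    fix u assume u: "u \<in> {s..t}"
    have "((\<lambda>s. pmf (P s) m) has_real_derivative E u (gen u (indicator {m}))) (at u within {0..})"
      unfolding expectation_drift_indicator using u assms by (intro forward) auto
    then have "((\<lambda>s. pmf (P s) m) has_real_derivative E u (gen u (indicator {m}))) (at u within {s..t})"
      by (rule DERIV_subset) (use assms in auto)
    then show "((\<lambda>s. pmf (P s) m) has_vector_derivative E u (gen u (indicator {m}))) (at u within {s..t})"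
      by (rule has_real_derivative_iff_has_vector_derivative[THEN iffD1])
  qed
  then show ?thesis by (simp add: measure_pmf_single)
qed

lemma dynkin_finite:
  fixes f :: "(cls \<Rightarrow> nat) \<Rightarrow> real"
  assumes "0 \<le> s" "s \<le> t" "finite S"
  defines "g \<equiv> (\<lambda>n. \<Sum>m\<in>S. f m * indicator {m} n)"
  shows "((\<lambda>u. E u (gen u g)) has_integral (E t g - E s g)) {s..t}"
proof -
  have int: "integrable (measure_pmf p) (\<lambda>n. indicator {k} n :: real)" for k :: "cls \<Rightarrow> nat" and p
    by (rule integrable_pmf_bounded[of _ 1]) (auto simp: indicator_def)
  have int': "integrable (measure_pmf p) (gen u (indicator {k}))" for k p u
    by (rule integrable_pmf_bounded[of _ "300 * 1"], rule abs_gen_le) (auto simp: indicator_def)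
  have 1: "E u (gen u g) = (\<Sum>m\<in>S. f m * E u (gen u (indicator {m})))" for u
    unfolding g_def drift_sum[abs_def] drift_cmult
    by (subst Bochner_Integration.integral_sum) (auto intro!: integrable_mult_right int')
  have 2: "E u g = (\<Sum>m\<in>S. f m * E u (indicator {m}))" for u
    unfolding g_def
    by (subst Bochner_Integration.integral_sum) (auto intro!: integrable_mult_right int)
  show ?thesis
    unfolding 1 2 sum_subtractf[symmetric] right_diff_distrib[symmetric]
    using assms by (intro has_integral_sum has_integral_mult_right dynkin_indicator)
qed

text \<open>The forward equation speaks of single states, hence of finitely supported functions.
  Since all rates are bounded, so are the truncations \<open>g k\<close> along an enumeration and
  their generators, uniformly in \<open>k\<close>; dominated convergence applies first under the law
  and then in time.\<close>

lemma dynkin: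
  assumes f: "\<And>n. \<bar>f n\<bar> \<le> B" and "0 \<le> s" "s \<le> t"
  shows "((\<lambda>u. E u (gen u f)) has_integral (E t f - E s f)) {s..t}"
proof -
  define S where "S = (\<lambda>k. {n :: cls \<Rightarrow> nat. to_nat n < k})"
  have fin: "finite (S k)" for k
  proof -
    have "S k = to_nat -` {..<k}" by (auto simp: S_def)
    then show ?thesis by (simp add: finite_vimageI)
  qed
  define g where "g = (\<lambda>k n. \<Sum>m\<in>S k. f m * indicator {m} n)"
  have g: "g k n = (if to_nat n < k then f n else 0)" for k n
  proof -
    have "g k n = (\<Sum>m\<in>S k. if n = m then f m else 0)"
      unfolding g_def by (intro sum.cong) (auto simp: indicator_def)
    then show ?thesis using fin[of k] by (simp add: S_def)
  qed
  have B: "0 \<le> B" using f[of "\<lambda>_. 0"] by linarith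
  have gB: "\<bar>g k n\<bar> \<le> B" for k n using f[of n] B by (simp add: g)
  have lim: "(\<lambda>k. g k n) \<longlonglongrightarrow> f n" for n
  proof (rule tendsto_eventually)
    show "\<forall>\<^sub>F k in sequentially. g k n = f n"
      using eventually_gt_at_top[of "to_nat n"] by eventually_elim (simp add: g)
  qed
  have E_lim: "(\<lambda>k. E u (h k)) \<longlonglongrightarrow> E u h'"
    if "\<And>n. (\<lambda>k. h k n) \<longlonglongrightarrow> h' n" "\<And>k n. \<bar>h k n\<bar> \<le> C" for u h h' C
    using that by (intro integral_dominated_convergence[where w = "\<lambda>_. C"]) auto
  show ?thesis
  proof (rule has_integral_dominated_convergence)
    show "((\<lambda>u. E u (gen u (g k))) has_integral (E t (g k) - E s (g k))) {s..t}" for k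
      unfolding g_def using assms fin by (intro dynkin_finite)
    show "(\<lambda>u. 300 * B) integrable_on {s..t}" by (rule integrable_const_ivl)
    show "\<forall>u\<in>{s..t}. norm (E u (gen u (g k))) \<le> 300 * B" for k
      using gB by (auto intro!: abs_expectation_le abs_gen_le)
    show "\<forall>u\<in>{s..t}. (\<lambda>k. E u (gen u (g k))) \<longlonglongrightarrow> E u (gen u f)"
    proof
      fix u
      have "(\<lambda>k. gen u (g k) n) \<longlonglongrightarrow> gen u f n" for n
        unfolding drift_def by (intro tendsto_intros lim)
      then show "(\<lambda>k. E u (gen u (g k))) \<longlonglongrightarrow> E u (gen u f)"
        using gB by (intro E_lim[where C = "300 * B"] abs_gen_le)
    qed
    show "(\<lambda>k. E t (g k) - E s (g k)) \<longlonglongrightarrow> E t f - E s f"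
      using gB lim by (intro tendsto_diff E_lim[where C = B])
  qed
qed

lemma E_lipschitz:
  assumes f: "\<And>n. \<bar>f n\<bar> \<le> B" and "0 \<le> s" "s \<le> t"
  shows "\<bar>E t f - E s f\<bar> \<le> 300 * B * (t - s)"
proof -
  have "0 \<le> B" using f[of "\<lambda>_. 0"] by linarith
  then have "norm (E t f - E s f) \<le> (300 * B) * measure lborel (cbox s t)"
    using dynkin[OF assms] f
    by (intro has_integral_bound[where f = "\<lambda>u. E u (gen u f)"])
      (auto intro!: abs_expectation_le abs_gen_le)
  then show ?thesis using assms by simp
qed

lemma continuous_E:
  assumes f: "\<And>n. \<bar>f n\<bar> \<le> B"
  shows "continuous_on {0..} (\<lambda>u. E u f)"
proof -
  have B: "0 \<le> B" using f[of "\<lambda>_. 0"] by linarith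
  have "(300 * B)-lipschitz_on {0..} (\<lambda>u. E u f)"
  proof (rule lipschitz_onI)
    fix s t :: real assume "s \<in> {0..}" "t \<in> {0..}"
    then show "dist (E s f) (E t f) \<le> 300 * B * dist s t"
      using E_lipschitz[OF f, of s t] E_lipschitz[OF f, of t s]
      by (cases "s \<le> t") (auto simp: dist_real_def abs_minus_commute)
  qed (use B in simp)
  then show ?thesis by (rule lipschitz_on_continuous_on)
qed

lemma continuous_outflow: "continuous_on {0..} (\<lambda>u. outflow (P u) a)"
  unfolding outflow_def using service_nonneg service_le by (intro continuous_E[of _ 10]) auto

lemma continuous_inflow: "continuous_on {0..} (\<lambda>u. inflow (P u) a)"
  by (cases a) (auto intro!: continuous_intros continuous_outflow)

lemma outflow_integrable: "0 \<le> s \<Longrightarrow> (\<lambda>u. outflow (P u) a) integrable_on {s..t}"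
  by (intro integrable_continuous_real continuous_on_subset[OF continuous_outflow]) auto

lemma inflow_integrable: "0 \<le> s \<Longrightarrow> (\<lambda>u. inflow (P u) a) integrable_on {s..t}"
  by (intro integrable_continuous_real continuous_on_subset[OF continuous_inflow]) auto

section \<open>Cumulative flows and the Euler step\<close>

definition arrivals :: "cls \<Rightarrow> real \<Rightarrow> real" where
  "arrivals a t = integral {0..t} (\<lambda>u. inflow (P u) a)"

definition departures :: "cls \<Rightarrow> real \<Rightarrow> real" where
  "departures a t = integral {0..t} (\<lambda>u. outflow (P u) a)"

lemma arrivals_0: "arrivals a 0 = 0"
  by (simp add: arrivals_def)

lemma has_integral_arrivals:
  assumes "0 \<le> s" "s \<le> t"
  shows "((\<lambda>u. inflow (P u) a) has_integral (arrivals a t - arrivals a s)) {s..t}"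
  using Henstock_Kurzweil_Integration.integral_combine[of 0 s t "\<lambda>u. inflow (P u) a"]
    inflow_integrable[of 0 a t] inflow_integrable[of s a t] assms
  by (simp add: arrivals_def has_integral_integrable_integral)

lemma arrivals_mono:
  assumes "0 \<le> s" "s \<le> t"
  shows "arrivals a s \<le> arrivals a t"
  using has_integral_nonneg[OF has_integral_arrivals[OF assms]] inflow_nonneg by simp

lemma arrivals_diff_le:
  assumes "0 \<le> s" "s \<le> t"
  shows "arrivals a t - arrivals a s \<le> 20 * (t - s)"
  using has_integral_le[OF has_integral_arrivals[OF assms] has_integral_const_real[of 20 s t]] inflow_le assms
  by (simp add: mult.commute)

lemma arrivals_balance:
  assumes "0 \<le> t"
  shows "arrivals K_O t = departures K_AB t + departures K_BA t"
    "arrivals K_A t = departures K_O t / 2" "arrivals K_B t = departures K_O t / 2"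
    "arrivals K_AB t = departures K_A t" "arrivals K_BA t = departures K_B t"
  unfolding arrivals_def departures_def
  by (simp_all add: integral_add outflow_integrable)

text \<open>Only the law is frozen at \<open>s\<close>. The rates are kept, and their integral is
  exactly the arrivals, so no modulus of continuity of the rates enters. Freezing costs
  \<open>300 * (300 * B) * (u - s)\<close>: \<open>E_lipschitz\<close> for a function that is itself
  bounded by \<open>300 * B\<close>.\<close>

lemma expectation_step:
  assumes f: "\<And>n. \<bar>f n\<bar> \<le> B" and st: "0 \<le> s" "s \<le> t"
  shows "\<bar>E t f - E s (\<lambda>n. f n + drift (\<lambda>a. arrivals a t - arrivals a s) (t - s) f n)\<bar>
    \<le> 90000 * B * (t - s)\<^sup>2"
proof -
  let ?R = "\<lambda>a. arrivals a t - arrivals a s"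
  have B: "0 \<le> B" using f[of "\<lambda>_. 0"] by linarith
  define up where "up = (\<lambda>a n. f (arrive a n) - f n)"
  define down where "down = (\<lambda>n. \<Sum>a\<in>UNIV. service a n * (f (depart a n) - f n))"
  have up: "\<bar>up a n\<bar> \<le> 2 * B" for a n
    unfolding up_def using f[of "arrive a n"] f[of n] by linarith
  have down: "\<bar>down n\<bar> \<le> 100 * B" for n
    using abs_drift_le[where f = f and B = B and r = "\<lambda>_. 0" and c = 0 and h = 1 and n = n] f unfolding drift_def down_def by simp
  have drift: "drift r h f n = (\<Sum>a\<in>UNIV. r a * up a n) + h * down n" for r h n
    by (simp add: drift_def up_def down_def)
  have int: "integrable (P s) (\<lambda>n. up a n)" "integrable (P s) down" "integrable (P s) f" for a
    using integrable_pmf_bounded[of "up a"] integrable_pmf_bounded[of down]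
      integrable_pmf_bounded[of f] up down f by blast+
  have E_drift: "E s (drift r h f) = (\<Sum>a\<in>UNIV. r a * E s (up a)) + h * E s down" for r h
    unfolding drift[abs_def] using int by simp
  have "((\<lambda>u. E s (gen u f)) has_integral E s (drift ?R (t - s) f)) {s..t}"
    unfolding E_drift using st has_integral_const_real[of "1 :: real" s t]
    by (intro has_integral_add has_integral_sum has_integral_mult_left has_integral_arrivals) auto
  then have *: "((\<lambda>u. E u (gen u f) - E s (gen u f)) has_integral
      (E t f - E s f - E s (drift ?R (t - s) f))) (cbox s t)"
    unfolding cbox_interval by (intro has_integral_diff dynkin[OF f st])
  have "norm (E u (gen u f) - E s (gen u f)) \<le> 90000 * B * (t - s)" if "u \<in> cbox s t" for u
  proof -
    have "\<bar>E u (gen u f) - E s (gen u f)\<bar> \<le> 300 * (300 * B) * (u - s)"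
      using st f that by (intro E_lipschitz abs_gen_le) auto
    also have "\<dots> \<le> 300 * (300 * B) * (t - s)"
      using B that by (intro mult_left_mono) auto
    finally show ?thesis by simp
  qed
  then have "norm (E t f - E s f - E s (drift ?R (t - s) f))
      \<le> (90000 * B * (t - s)) * measure lborel (cbox s t)"
    using B st by (intro has_integral_bound[OF _ *]) auto
  moreover have "integrable (P s) (drift ?R (t - s) f)"
    unfolding drift[abs_def] using int by auto
  ultimately show ?thesis
    using st int(3) by (simp add: power2_eq_square mult.assoc diff_diff_eq)
qed

section \<open>Comparison along the process\<close>

text \<open>Applied to an inf-convolution, this replaces a coupling of the process with the fluid.\<close>

lemma comparison:
  fixes u :: "'j \<Rightarrow> real \<Rightarrow> (cls \<Rightarrow> nat) \<Rightarrow> real"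
  assumes nonneg: "\<And>j s n. 0 \<le> u j s n"
    and super: "\<And>j s t n. 0 \<le> s \<Longrightarrow> s \<le> t \<Longrightarrow> t \<le> \<tau> \<Longrightarrow>
      u j t n + drift (\<lambda>a. arrivals a t - arrivals a s) (t - s) (u j t) n
        \<le> u j s n + \<epsilon> * (t - s) + D * (t - s)\<^sup>2"
    and "0 \<le> \<epsilon>" "0 \<le> D" "0 \<le> \<tau>"
  defines "g \<equiv> (\<lambda>s n. min 1 (INF j. u j s n))"
  shows "E \<tau> (g \<tau>) \<le> E 0 (g 0) + \<epsilon> * \<tau>"
proof -
  let ?R = "\<lambda>s t a. arrivals a t - arrivals a s"
  define D' where "D' = D + 90000"
  have bdd: "bdd_below (range (\<lambda>j. u j s n))" for s n
    by (rule bdd_belowI2[of _ 0]) (rule nonneg)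
  have g_le: "g s n \<le> u j s n" for s n j
  proof -
    have "(INF j. u j s n) \<le> u j s n" by (rule cINF_lower[OF bdd]) simp
    then show ?thesis unfolding g_def by simp
  qed
  have g_1: "g s n \<le> 1" for s n by (simp add: g_def)
  have g_0: "0 \<le> g s n" for s n unfolding g_def by (auto intro: cINF_greatest nonneg)
  have g_abs: "\<bar>g s n\<bar> \<le> 1" for s n using g_0[of s n] g_1[of s n] by simp
  \<comment> \<open>The step must be short enough for \<open>drift_mono\<close>: arrivals contribute
    at most \<open>5 * 20 * (t - s)\<close> and services \<open>50 * (t - s)\<close>, together
    \<open>150 * (t - s)\<close>. The inequality then passes to the infimum, one index
    \<open>j\<close> at a time.\<close>
  have point: "g t n + drift (?R s t) (t - s) (g t) n \<le> g s n + \<epsilon> * (t - s) + D * (t - s)\<^sup>2"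
    if st: "0 \<le> s" "s \<le> t" "t \<le> \<tau>" "150 * (t - s) \<le> 1" for s t n
  proof -
    have e: "0 \<le> \<epsilon> * (t - s) + D * (t - s)\<^sup>2" using st assms by simp
    have R: "0 \<le> ?R s t a" for a using arrivals_mono[of s t] st by simp
    have "(\<Sum>a\<in>UNIV. ?R s t a) \<le> (\<Sum>a\<in>(UNIV::cls set). 20 * (t - s))"
      using st by (intro sum_mono arrivals_diff_le)
    then have small: "(\<Sum>a\<in>UNIV. ?R s t a) + 50 * (t - s) \<le> 1" using st by (simp add: CARD_cls)
    have le: "g t n + drift (?R s t) (t - s) (g t) n \<le> v n + drift (?R s t) (t - s) v n"
      if "\<And>n. g t n \<le> v n" for v
      using that R small st by (intro drift_mono) auto
    \<comment> \<open>Constants have zero drift, so the cap at 1 is preserved. It makes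
      \<open>g\<close> bounded, as \<open>expectation_step\<close> requires, whereas the functions
      \<open>u\<close> may be unbounded and enter only pointwise.\<close>
    have "g t n + drift (?R s t) (t - s) (g t) n \<le> 1"
      using le[of "\<lambda>_. 1"] g_1 by (simp add: drift_def)
    moreover have "g t n + drift (?R s t) (t - s) (g t) n - (\<epsilon> * (t - s) + D * (t - s)\<^sup>2)
        \<le> (INF j. u j s n)"
    proof (rule cINF_greatest)
      fix j
      have "g t n + drift (?R s t) (t - s) (g t) n \<le> u j s n + \<epsilon> * (t - s) + D * (t - s)\<^sup>2"
        using le[of "u j t"] g_le super[of s t j n] st by force
      then show "g t n + drift (?R s t) (t - s) (g t) n - (\<epsilon> * (t - s) + D * (t - s)\<^sup>2) \<le> u j s n"
        by simp
    qed simp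
    ultimately show ?thesis using e unfolding g_def[of] by linarith
  qed
  have step: "E t (g t) \<le> E s (g s) + \<epsilon> * (t - s) + D' * (t - s)\<^sup>2"
    if st: "0 \<le> s" "s \<le> t" "t \<le> \<tau>" "150 * (t - s) \<le> 1" for s t
  proof -
    let ?f = "\<lambda>n. g t n + drift (?R s t) (t - s) (g t) n"
    have R: "\<bar>?R s t a\<bar> \<le> 20 * (t - s)" for a
      using arrivals_mono[of s t a] arrivals_diff_le[of s t a] st by simp
    have f: "\<bar>?f n\<bar> \<le> 1 + 10 * 1 * (20 * (t - s) + 10 * (t - s))" for n
    proof -
      have "\<bar>drift (?R s t) (t - s) (g t) n\<bar> \<le> 10 * 1 * (20 * (t - s) + 10 * (t - s))"
        by (rule abs_drift_le) (use g_abs R st in auto)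
      then show ?thesis using g_abs[of t n] by linarith
    qed
    have "E s ?f \<le> E s (\<lambda>n. g s n + (\<epsilon> * (t - s) + D * (t - s)\<^sup>2))"
    proof (rule expectation_mono_bounded[OF f])
      show "\<bar>g s n + (\<epsilon> * (t - s) + D * (t - s)\<^sup>2)\<bar> \<le> 1 + (\<epsilon> * (t - s) + D * (t - s)\<^sup>2)" for n
        using g_0[of s n] g_1[of s n] assms(3,4) st by simp
      show "?f n \<le> g s n + (\<epsilon> * (t - s) + D * (t - s)\<^sup>2)" for n
        using point[OF st, of n] by simp
    qed
    also have "\<dots> = E s (g s) + (\<epsilon> * (t - s) + D * (t - s)\<^sup>2)"
      using integrable_pmf_bounded[of "g s" 1 "P s"] g_abs by simp
    finally have "E s ?f \<le> E s (g s) + (\<epsilon> * (t - s) + D * (t - s)\<^sup>2)" .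
    moreover have "\<bar>E t (g t) - E s ?f\<bar> \<le> 90000 * 1 * (t - s)\<^sup>2"
      using g_abs st by (intro expectation_step) auto
    ultimately show ?thesis by (simp add: D'_def distrib_right)
  qed
  \<comment> \<open>With \<open>m\<close> equal steps the second-order errors add up to
    \<open>D' * \<tau>\<^sup>2 / m\<close>, which vanishes as \<open>m\<close> grows; the
    first-order error \<open>\<epsilon> * \<tau>\<close> remains.\<close>
  have bound: "E \<tau> (g \<tau>) \<le> E 0 (g 0) + \<epsilon> * \<tau> + D' * \<tau>\<^sup>2 / real m"
    if m: "0 < m" "150 * \<tau> \<le> real m" for m
  proof -
    define h where "h = \<tau> / real m"
    have h: "0 \<le> h" "150 * h \<le> 1" "real m * h = \<tau>"
      using m \<open>0 \<le> \<tau>\<close> by (auto simp: h_def field_simps)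
    have "E (real k * h) (g (real k * h)) \<le> E 0 (g 0) + real k * (\<epsilon> * h + D' * h\<^sup>2)" if "k \<le> m" for k
      using that
    proof (induction k)
      case (Suc k)
      have "real (Suc k) * h \<le> real m * h" using Suc.prems h by (intro mult_right_mono) auto
      then have "E (real (Suc k) * h) (g (real (Suc k) * h))
          \<le> E (real k * h) (g (real k * h)) + \<epsilon> * h + D' * h\<^sup>2"
        using step[of "real k * h" "real (Suc k) * h"] h by (simp add: algebra_simps)
      then show ?case using Suc by (simp add: algebra_simps)
    qed simp
    from this[of m] have "E \<tau> (g \<tau>) \<le> E 0 (g 0) + real m * (\<epsilon> * h + D' * h\<^sup>2)" using h by simp
    also have "real m * (\<epsilon> * h + D' * h\<^sup>2) = \<epsilon> * (real m * h) + D' * (real m * h) * h"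
      by (simp add: power2_eq_square algebra_simps)
    also have "D' * (real m * h) * h = D' * \<tau>\<^sup>2 / real m"
      unfolding h(3) by (simp add: h_def power2_eq_square)
    finally show ?thesis by (simp add: h(3))
  qed
  have "(\<lambda>m. E 0 (g 0) + \<epsilon> * \<tau> + D' * \<tau>\<^sup>2 / real m) \<longlonglongrightarrow> E 0 (g 0) + \<epsilon> * \<tau> + 0"
    by (intro tendsto_add tendsto_const lim_const_over_n)
  moreover have "\<forall>\<^sub>F m in sequentially. E \<tau> (g \<tau>) \<le> E 0 (g 0) + \<epsilon> * \<tau> + D' * \<tau>\<^sup>2 / real m"
    using eventually_gt_at_top[of 0] eventually_ge_at_top[of "nat \<lceil>150 * \<tau>\<rceil>"]
    by eventually_elim (rule bound, auto simp: nat_le_iff ceiling_le_iff)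
  ultimately show ?thesis
    using tendsto_lowerbound[of _ _ sequentially] by fastforce
qed

text \<open>\<open>dynkin\<close> needs a bounded function, so the coordinate is truncated at
  \<open>M\<close>. Truncation keeps unit jumps at most 1, which bounds the generator by 20 + 10
  uniformly in \<open>M\<close>; the general bound would grow with \<open>M\<close>. Departures from
  an empty class do no harm, because its service rate is 0.\<close>

lemma first_moment_balance:
  assumes "0 \<le> t" and int: "integrable (P 0) (\<lambda>n. real (n a))" "integrable (P t) (\<lambda>n. real (n a))"
  shows "E t (\<lambda>n. real (n a)) - E 0 (\<lambda>n. real (n a)) = arrivals a t - departures a t"
proof -
  define f where "f = (\<lambda>M n. min (real (n a)) (real M) :: real)"
  have f: "\<bar>f M n\<bar> \<le> real M" for M n by (simp add: f_def)
  have lim: "(\<lambda>M. f M n) \<longlonglongrightarrow> real (n a)" for n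
  proof (rule tendsto_eventually)
    show "\<forall>\<^sub>F M in sequentially. f M n = real (n a)"
      using eventually_ge_at_top[of "n a"] by eventually_elim (simp add: f_def)
  qed
  have E_lim: "(\<lambda>M. E u (f M)) \<longlonglongrightarrow> E u (\<lambda>n. real (n a))" if "integrable (P u) (\<lambda>n. real (n a))" for u
    using that lim by (intro integral_dominated_convergence[where w = "\<lambda>n. real (n a)"]) (auto simp: f_def)
  have d: "gen u (f M) n = inflow (P u) a * (f M (arrive a n) - f M n)
      + service a n * (f M (depart a n) - f M n)" for u M n
  proof -
    have "gen u (f M) n = (\<Sum>b\<in>UNIV. if b = a then inflow (P u) a * (f M (arrive a n) - f M n) else 0)
        + (\<Sum>b\<in>UNIV. if b = a then service a n * (f M (depart a n) - f M n) else 0)"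
      unfolding drift_def mult_1 by (intro arg_cong2[of _ _ _ _ "(+)"] sum.cong) (auto simp: f_def)
    then show ?thesis by simp
  qed
  have jump: "\<bar>f M (arrive a n) - f M n\<bar> \<le> 1" "\<bar>f M (depart a n) - f M n\<bar> \<le> 1" for M n
    by (auto simp: f_def)
  have dB: "\<bar>gen u (f M) n\<bar> \<le> 30" for u M n
  proof -
    have "\<bar>inflow (P u) a * (f M (arrive a n) - f M n)\<bar> \<le> 20 * 1"
      unfolding abs_mult using inflow_nonneg inflow_le jump by (intro mult_mono) auto
    moreover have "\<bar>service a n * (f M (depart a n) - f M n)\<bar> \<le> 10 * 1"
      unfolding abs_mult using service_nonneg service_le jump by (intro mult_mono) auto
    ultimately show ?thesis unfolding d by linarith
  qed
  have dlim: "(\<lambda>M. gen u (f M) n) \<longlonglongrightarrow> inflow (P u) a - service a n" for u n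
  proof (rule tendsto_eventually)
    show "\<forall>\<^sub>F M in sequentially. gen u (f M) n = inflow (P u) a - service a n"
      using eventually_gt_at_top[of "n a"]
      by eventually_elim (unfold d, cases "n a = 0"; auto simp: f_def service_eq_0 of_nat_diff algebra_simps)
  qed
  have "((\<lambda>u. inflow (P u) a - outflow (P u) a) has_integral
      (E t (\<lambda>n. real (n a)) - E 0 (\<lambda>n. real (n a)))) {0..t}"
  proof (rule has_integral_dominated_convergence)
    show "((\<lambda>u. E u (gen u (f M))) has_integral (E t (f M) - E 0 (f M))) {0..t}" for M
      using f \<open>0 \<le> t\<close> by (intro dynkin) auto
    show "(\<lambda>u. 30) integrable_on {0..t}" by (rule integrable_const_ivl)
    show "\<forall>u\<in>{0..t}. norm (E u (gen u (f M))) \<le> 30" for M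
      using dB by (auto intro!: abs_expectation_le)
    show "\<forall>u\<in>{0..t}. (\<lambda>M. E u (gen u (f M))) \<longlonglongrightarrow> inflow (P u) a - outflow (P u) a"
    proof
      fix u
      have "(\<lambda>M. E u (gen u (f M))) \<longlonglongrightarrow> E u (\<lambda>n. inflow (P u) a - service a n)"
        using dB dlim by (intro integral_dominated_convergence[where w = "\<lambda>_. 30"]) auto
      also have "E u (\<lambda>n. inflow (P u) a - service a n) = inflow (P u) a - outflow (P u) a"
        using integrable_service by (simp add: outflow_def)
      finally show "(\<lambda>M. E u (gen u (f M))) \<longlonglongrightarrow> inflow (P u) a - outflow (P u) a" .
    qed
    show "(\<lambda>M. E t (f M) - E 0 (f M)) \<longlonglongrightarrow> E t (\<lambda>n. real (n a)) - E 0 (\<lambda>n. real (n a))"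
      using int by (intro tendsto_diff E_lim)
  qed
  moreover have "((\<lambda>u. inflow (P u) a - outflow (P u) a) has_integral
      (arrivals a t - departures a t)) {0..t}"
    unfolding arrivals_def departures_def
    by (intro has_integral_diff integrable_integral inflow_integrable outflow_integrable) auto
  ultimately show ?thesis by (rule has_integral_unique)
qed

end

section \<open>Distance to the fluid\<close>

abbreviation queue_at :: "nat \<Rightarrow> cls \<Rightarrow> (cls \<Rightarrow> nat) \<Rightarrow> real" where
  "queue_at N i n \<equiv> queue i (($) (scaled N n))"

lemma queue_at_arrive: "queue_at N i (arrive a n) = queue_at N i n + queue_weight i a / real N"
  by (cases i; cases a) (simp_all add: scaled_def queue_simps queue_weight_def add_divide_distrib)

lemma queue_at_depart:
  "n a \<noteq> 0 \<Longrightarrow> queue_at N i (depart a n) = queue_at N i n - queue_weight i a / real N"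
  by (cases i; cases a)
    (simp_all add: scaled_def queue_simps queue_weight_def add_divide_distrib diff_divide_distrib of_nat_diff)

lemma queue_at_nonneg: "0 \<le> queue_at N i n"
  unfolding queue_def scaled_def
  by (intro sum_nonneg mult_nonneg_nonneg queue_weight_nonneg) simp

lemma queue_at_service:
  assumes "0 < N"
  shows "(\<Sum>a\<in>UNIV. queue_weight i a * service a n) =
    (if queue_at N i n = 0 then 0 else queue_speed i)"
proof -
  have "queue_at N i n = queue i (\<lambda>a. real (n a)) / real N"
    by (simp add: queue_def scaled_def sum_divide_distrib)
  then show ?thesis using assms by (simp add: queue_service)
qed

text \<open>Expanding the square leaves a transport term and the variance of the jumps. Squared
  weights are at most 25, and five classes with arrivals up to \<open>20 * h\<close> and services up
  to \<open>10 * h\<close> give 25 * 5 * 30 = 3750.\<close>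

lemma drift_square_distance:
  assumes "0 < N" and r: "\<And>a. 0 \<le> r a" "\<And>a. r a \<le> 20 * h"
  shows "drift r h (\<lambda>n. (queue_at N i n - w)\<^sup>2) n
    \<le> 2 * (queue_at N i n - w) *
        (queue i r - h * (if queue_at N i n = 0 then 0 else queue_speed i)) / real N
      + 3750 * h / (real N)\<^sup>2"
proof -
  let ?q = "queue_at N i n" and ?c = "queue_weight i"
  define d where "d = ?q - w"
  have h: "0 \<le> h" using order_trans[OF r(1) r(2)] by simp
  have up: "r a * ((queue_at N i (arrive a n) - w)\<^sup>2 - (?q - w)\<^sup>2)
      = 2 * (?q - w) / real N * (?c a * r a) + (?c a)\<^sup>2 * r a / (real N)\<^sup>2" for a
    unfolding queue_at_arrive using assms(1) by (simp add: field_simps power2_eq_square)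
  have down: "service a n * ((queue_at N i (depart a n) - w)\<^sup>2 - (?q - w)\<^sup>2)
      = - 2 * (?q - w) / real N * (?c a * service a n) + (?c a)\<^sup>2 * service a n / (real N)\<^sup>2" for a
  proof (cases "n a = 0")
    case False
    then show ?thesis
      unfolding queue_at_depart[of n a, OF False] using assms(1)
      by (simp add: field_simps power2_eq_square)
  qed (simp add: service_eq_0)
  have c2: "(?c a)\<^sup>2 \<le> 25" for a
    using queue_weight_nonneg[of i a] queue_weight_le[of i a]
      power_mono[of "?c a" 5 2] by simp
  have "drift r h (\<lambda>n. (queue_at N i n - w)\<^sup>2) n =
      2 * (?q - w) / real N * (\<Sum>a\<in>UNIV. ?c a * r a)
      - h * (2 * (?q - w) / real N * (\<Sum>a\<in>UNIV. ?c a * service a n))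
      + ((\<Sum>a\<in>UNIV. (?c a)\<^sup>2 * r a) + h * (\<Sum>a\<in>UNIV. (?c a)\<^sup>2 * service a n)) / (real N)\<^sup>2"
    unfolding drift_def up down sum.distrib sum_distrib_left[symmetric] sum_divide_distrib[symmetric]
    unfolding d_def[symmetric] by (simp add: distrib_left right_diff_distrib add_divide_distrib)
  moreover have "(\<Sum>a\<in>UNIV. (?c a)\<^sup>2 * r a) \<le> (\<Sum>a\<in>(UNIV::cls set). 25 * (20 * h))"
    using c2 r h by (intro sum_mono mult_mono) auto
  moreover have "(\<Sum>a\<in>UNIV. (?c a)\<^sup>2 * service a n) \<le> (\<Sum>a\<in>(UNIV::cls set). 25 * 10)"
    using c2 service_nonneg service_le by (intro sum_mono mult_mono) auto
  then have "h * (\<Sum>a\<in>UNIV. (?c a)\<^sup>2 * service a n) \<le> h * 1250"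
    using h by (intro mult_left_mono) (auto simp: CARD_cls)
  ultimately have "drift r h (\<lambda>n. (queue_at N i n - w)\<^sup>2) n \<le>
      2 * (?q - w) / real N * (\<Sum>a\<in>UNIV. ?c a * r a)
      - h * (2 * (?q - w) / real N * (\<Sum>a\<in>UNIV. ?c a * service a n)) + 3750 * h / (real N)\<^sup>2"
    by (simp add: CARD_cls divide_right_mono)
  also have "\<dots> = 2 * (?q - w) *
        (queue i r - h * (\<Sum>a\<in>UNIV. ?c a * service a n)) / real N + 3750 * h / (real N)\<^sup>2"
  proof -
    have "2 * d / real N * A - h * (2 * d / real N * B) = 2 * d * (A - h * B) / real N" for d A B
      using assms(1) by (simp add: field_simps)
    then show ?thesis by (simp only: queue_def)
  qed
  finally show ?thesis unfolding queue_at_service[OF assms(1)] .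
qed

text \<open>Reflection decreases the distance: both the empty queue and the reflection term of the fluid
  push the two towards each other.\<close>

lemma square_distance_step:
  assumes "0 < N" and r: "\<And>a. 0 \<le> r a" "\<And>a. r a \<le> 20 * h"
    and w: "w' - w = (queue i r - queue_speed i * h) / real N + l" "0 \<le> w'" "0 \<le> l" "l * w' \<le> e"
  shows "(queue_at N i n - w')\<^sup>2 + drift r h (\<lambda>n. (queue_at N i n - w')\<^sup>2) n
    \<le> (queue_at N i n - w)\<^sup>2 + 3750 * h / (real N)\<^sup>2 + 2 * e"
proof -
  let ?q = "queue_at N i n"
  define v where "v = (if ?q = 0 then 0 else queue_speed i)"
  have h: "0 \<le> h" using order_trans[OF r(1) r(2)] by simp
  have "(?q - w')\<^sup>2 - (?q - w)\<^sup>2 = - 2 * (?q - w') * (w' - w) - (w' - w)\<^sup>2"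
    by (simp add: power2_eq_square algebra_simps)
  also have "\<dots> \<le> - 2 * (?q - w') * (w' - w)" by simp
  finally have "(?q - w')\<^sup>2 - (?q - w)\<^sup>2 + 2 * (?q - w') * (queue i r - h * v) / real N
      \<le> 2 * (?q - w') * ((queue i r - h * v) / real N - (w' - w))"
  proof -
    have "2 * d * A / real N - 2 * d * D = 2 * d * (A / real N - D)" for d A D :: real
      by (simp add: right_diff_distrib)
    from this[of "?q - w'" "queue i r - h * v" "w' - w"]
    show ?thesis if "(?q - w')\<^sup>2 - (?q - w)\<^sup>2 \<le> - 2 * (?q - w') * (w' - w)"
      using that by linarith
  qed
  also have "(queue i r - h * v) / real N - (w' - w) = (queue_speed i - v) * h / real N - l"
    unfolding w(1) by (simp add: diff_divide_distrib algebra_simps)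
  finally have "(?q - w')\<^sup>2 - (?q - w)\<^sup>2 + 2 * (?q - w') * (queue i r - h * v) / real N
      \<le> 2 * (?q - w') * ((queue_speed i - v) * h / real N - l)" .
  \<comment> \<open>What survives is \<open>l * w'\<close>, which \<open>workload_step\<close> makes
    quadratic in the length of the step and which therefore disappears in
    \<open>comparison\<close>.\<close>
  also have "\<dots> \<le> 2 * (l * w')"
  proof (cases "?q = 0")
    case True
    have "0 \<le> w' * ((queue_speed i - v) * h / real N)"
      using True w(2) h queue_speed_nonneg[of i] by (simp add: v_def)
    moreover have "2 * (0 - w') * (z - l) = 2 * (l * w') - 2 * (w' * z)" for z
      by (simp add: algebra_simps)
    ultimately show ?thesis using True by simp
  next
    case False
    then show ?thesis using mult_nonneg_nonneg[OF w(3) queue_at_nonneg[of i N n]]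
      by (simp add: v_def algebra_simps)
  qed
  finally have "(?q - w')\<^sup>2 - (?q - w)\<^sup>2 + 2 * (?q - w') * (queue i r - h * v) / real N \<le> 2 * e"
    using w(4) by linarith
  then show ?thesis
    using drift_square_distance[OF assms(1), of r h i w' n] r unfolding v_def by simp
qed

section \<open>Scaled arrivals and the inf-convolution estimate\<close>

context network
begin

definition scaled_arrivals :: "nat \<Rightarrow> cls \<Rightarrow> real \<Rightarrow> real" where
  "scaled_arrivals N a s = arrivals a (real N * s) / real N"

lemma scaled_arrivals_0: "scaled_arrivals N a 0 = 0"
  by (simp add: scaled_arrivals_def arrivals_0)

lemma scaled_arrivals_mono:
  assumes "0 \<le> s" "s \<le> t"
  shows "scaled_arrivals N a s \<le> scaled_arrivals N a t"
  unfolding scaled_arrivals_def using assms by (intro divide_right_mono arrivals_mono mult_left_mono) auto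

text \<open>Speeding up time by \<open>N\<close> cancels against division by \<open>N\<close>, so
  the constant does not depend on \<open>N\<close>; this equicontinuity is the source of
  compactness. For \<open>N = 0\<close> division by zero makes the function vanish.\<close>

lemma scaled_arrivals_lipschitz: "20-lipschitz_on {0..T} (scaled_arrivals N a)"
proof (rule lipschitz_onI)
  have "scaled_arrivals N a t - scaled_arrivals N a s \<le> 20 * (t - s)" if "0 \<le> s" "s \<le> t" for s t
  proof (cases "N = 0")
    case False
    have "arrivals a (real N * t) - arrivals a (real N * s) \<le> 20 * (real N * t - real N * s)"
      using that by (intro arrivals_diff_le mult_left_mono) auto
    then have "(arrivals a (real N * t) - arrivals a (real N * s)) / real N
        \<le> 20 * (real N * t - real N * s) / real N"
      by (rule divide_right_mono) simp
    also have "\<dots> = 20 * (t - s)" using False by (simp add: field_simps)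
    finally show ?thesis by (simp add: scaled_arrivals_def diff_divide_distrib)
  qed (use that in \<open>simp add: scaled_arrivals_def\<close>)
  then show "dist (scaled_arrivals N a s) (scaled_arrivals N a t) \<le> 20 * dist s t"
    if "s \<in> {0..T}" "t \<in> {0..T}" for s t
    using that scaled_arrivals_mono[of s t N a] scaled_arrivals_mono[of t s N a]
    by (cases "s \<le> t") (auto simp: dist_real_def)
qed simp

lemma scaled_arrivals_bdd_below: "bdd_below (scaled_arrivals N a ` {0..t})"
  using lipschitz_bdd_below[OF scaled_arrivals_lipschitz order_refl] .

lemma queue_scaled_arrivals_lipschitz: "500-lipschitz_on {0..T} (\<lambda>s. queue i (\<lambda>a. scaled_arrivals N a s))"
proof (rule lipschitz_onI)
  fix s t assume st: "s \<in> {0..T}" "t \<in> {0..T}"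
  have "\<bar>queue i (\<lambda>a. scaled_arrivals N a s - scaled_arrivals N a t)\<bar>
      \<le> 5 * (\<Sum>a\<in>(UNIV::cls set). 20 * dist s t)"
    using lipschitz_onD[OF scaled_arrivals_lipschitz] st
    by (intro order_trans[OF abs_queue_le] mult_left_mono sum_mono) (auto simp: dist_real_def)
  then show "dist (queue i (\<lambda>a. scaled_arrivals N a s)) (queue i (\<lambda>a. scaled_arrivals N a t))
      \<le> 500 * dist s t"
    by (simp add: queue_diff dist_real_def CARD_cls)
qed simp

text \<open>\<open>comparison\<close> runs in process time, so the fluid is read at
  \<open>s / real N\<close>. The index \<open>j\<close> is the starting point \<open>x\<close>, and
  \<open>\<psi> x\<close> is constant along each fluid path. Five squares gain
  \<open>5 * 3750 = 18750\<close> times \<open>K / N^2\<close> per unit of process time, over a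
  duration \<open>real N * t\<close>.\<close>

lemma inf_convolution_decay:
  assumes "0 < N" "0 \<le> t" "0 \<le> K" and nonneg: "\<And>x. 0 \<le> \<psi> x"
  defines "g \<equiv> (\<lambda>s n. min 1 (INF x. \<psi> x + K * (\<Sum>i\<in>UNIV. (queue_at N i n
      - queue i (($) (fluid_flow (scaled_arrivals N) s x)))\<^sup>2)))"
  shows "E (real N * t) (g t) \<le> E 0 (g 0) + 18750 * K * t / real N"
proof -
  define w where "w = (\<lambda>i x s. queue i (($) (fluid_flow (scaled_arrivals N) (s / real N) x)))"
  define u where "u = (\<lambda>x s n. \<psi> x + K * (\<Sum>i\<in>UNIV. (queue_at N i n - w i x s)\<^sup>2))"
  \<comment> \<open>Here 510 is the Lipschitz constant 500 of the queue inflow plus the largest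
    service speed 10.\<close>
  define e where "e = 510\<^sup>2 / (real N)\<^sup>2"
  let ?R = "\<lambda>s t a. arrivals a t - arrivals a s"
  have "E (real N * t) (\<lambda>n. min 1 (INF x. u x (real N * t) n))
      \<le> E 0 (\<lambda>n. min 1 (INF x. u x 0 n)) + (18750 * K / (real N)\<^sup>2) * (real N * t)"
  proof (rule comparison)
    show "0 \<le> u x s n" for x s n
      unfolding u_def using nonneg \<open>0 \<le> K\<close> by (intro add_nonneg_nonneg mult_nonneg_nonneg sum_nonneg) auto
    fix x n and s t :: real assume st: "0 \<le> s" "s \<le> t"
    have "(queue_at N i n - w i x t)\<^sup>2 + drift (?R s t) (t - s) (\<lambda>n. (queue_at N i n - w i x t)\<^sup>2) n
      \<le> (queue_at N i n - w i x s)\<^sup>2 + 3750 * (t - s) / (real N)\<^sup>2 + 2 * (e * (t - s)\<^sup>2)" for i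
    proof -
      have le: "0 \<le> s / real N" "s / real N \<le> t / real N"
        using st by (auto intro: divide_right_mono)
      obtain l where l: "0 \<le> l"
        "w i x t - w i x s = queue i (\<lambda>a. scaled_arrivals N a (t / real N))
          - queue i (\<lambda>a. scaled_arrivals N a (s / real N)) - queue_speed i * (t / real N - s / real N) + l"
        "l * w i x t \<le> (500 + queue_speed i)\<^sup>2 * (t / real N - s / real N)\<^sup>2"
        using workload_step[OF queue_scaled_arrivals_lipschitz queue_speed_nonneg le order_refl]
        unfolding w_def queue_fluid_flow by blast
      have "queue i (\<lambda>a. scaled_arrivals N a (t / real N))
          - queue i (\<lambda>a. scaled_arrivals N a (s / real N)) = queue i (?R s t) / real N"
        using \<open>0 < N\<close> unfolding queue_diff[symmetric]
        by (simp add: queue_def scaled_arrivals_def sum_divide_distrib diff_divide_distrib[symmetric])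
      then have 1: "w i x t - w i x s = (queue i (?R s t) - queue_speed i * (t - s)) / real N + l"
        unfolding l(2) by (simp add: diff_divide_distrib right_diff_distrib)
      have "l * w i x t \<le> (500 + queue_speed i)\<^sup>2 * ((t - s) / real N)\<^sup>2"
        using l(3) by (simp add: diff_divide_distrib)
      also have "\<dots> \<le> 510\<^sup>2 * ((t - s) / real N)\<^sup>2"
        using queue_speed_nonneg[of i] queue_speed_le[of i] by (intro mult_right_mono power_mono) auto
      finally have 2: "l * w i x t \<le> e * (t - s)\<^sup>2"
        by (simp add: e_def power_divide)
      \<comment> \<open>Reflection yields a nonnegative path from any starting value, so the infimum
        may run over all of \<open>pt\<close> and not just over the orthant.\<close>
      have 3: "0 \<le> w i x t"
        unfolding w_def queue_fluid_flow using st
        by (intro workload_nonneg lipschitz_bdd_below[OF queue_scaled_arrivals_lipschitz order_refl]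
            queue_speed_nonneg) auto
      show ?thesis
        using st arrivals_mono[of s t] arrivals_diff_le[of s t]
        by (intro square_distance_step[OF \<open>0 < N\<close> _ _ 1 3 l(1) 2]) auto
    qed
    then have "(\<Sum>i\<in>UNIV. (queue_at N i n - w i x t)\<^sup>2
        + drift (?R s t) (t - s) (\<lambda>n. (queue_at N i n - w i x t)\<^sup>2) n)
      \<le> (\<Sum>i\<in>UNIV. (queue_at N i n - w i x s)\<^sup>2 + (3750 * (t - s) / (real N)\<^sup>2 + 2 * (e * (t - s)\<^sup>2)))"
      by (intro sum_mono) (simp add: add.assoc)
    then have "K * ((\<Sum>i\<in>UNIV. (queue_at N i n - w i x t)\<^sup>2)
        + drift (?R s t) (t - s) (\<lambda>n. \<Sum>i\<in>UNIV. (queue_at N i n - w i x t)\<^sup>2) n)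
      \<le> K * ((\<Sum>i\<in>UNIV. (queue_at N i n - w i x s)\<^sup>2)
        + 5 * (3750 * (t - s) / (real N)\<^sup>2 + 2 * (e * (t - s)\<^sup>2)))"
      using \<open>0 \<le> K\<close> by (intro mult_left_mono) (simp_all add: drift_sum sum.distrib CARD_cls)
    moreover have "drift (?R s t) (t - s) (u x t) n
        = K * drift (?R s t) (t - s) (\<lambda>n. \<Sum>i\<in>UNIV. (queue_at N i n - w i x t)\<^sup>2) n"
      unfolding drift_cmult[symmetric] by (simp add: drift_def u_def)
    ultimately show "u x t n + drift (?R s t) (t - s) (u x t) n
        \<le> u x s n + 18750 * K / (real N)\<^sup>2 * (t - s) + 10 * K * e * (t - s)\<^sup>2"
      unfolding u_def by (simp add: algebra_simps)
  qed (use assms in \<open>auto simp: e_def\<close>)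
  also have "(18750 * K / (real N)\<^sup>2) * (real N * t) = 18750 * K * t / real N"
    using \<open>0 < N\<close> by (simp add: power2_eq_square)
  finally show ?thesis using \<open>0 < N\<close> by (simp add: g_def u_def w_def)
qed

text \<open>At time 0 the competitor \<open>x = scaled N n\<close> has no penalty and yields the
  fluid image of the state. At time \<open>t\<close> a distant fluid point is too expensive, while a
  near one changes \<open>\<phi>\<close> only a little. The two errors pull \<open>K\<close> in
  opposite directions.\<close>

lemma fluid_approximation:
  assumes "0 < N" "0 \<le> t" "0 < K"
    and \<phi>: "\<And>x. 0 \<le> \<phi> x" "\<And>x. \<phi> x \<le> 1" "\<And>x y. \<bar>\<phi> x - \<phi> y\<bar> \<le> L * l1_dist x y"
  shows "E (real N * t) (\<lambda>n. \<phi> (scaled N n))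
    \<le> E 0 (\<lambda>n. \<phi> (fluid_flow (scaled_arrivals N) t (scaled N n)))
      + 45 * L\<^sup>2 / K + 18750 * K * t / real N"
proof -
  let ?F = "fluid_flow (scaled_arrivals N)"
  define c where "c = (\<lambda>s n x. \<Sum>i\<in>UNIV. (queue_at N i n - queue i (($) (?F s x)))\<^sup>2)"
  define g where "g = (\<lambda>s n. min 1 (INF x. \<phi> (?F t x) + K * c s n x))"
  have c0: "0 \<le> c s n x" for s n x unfolding c_def by (intro sum_nonneg) auto
  have bdd: "bdd_below (range (\<lambda>x. \<phi> (?F t x) + K * c s n x))" for s n
    using c0 \<phi>(1) \<open>0 < K\<close> by (intro bdd_belowI2[of _ 0]) (simp add: add_nonneg_nonneg)
  have L: "0 \<le> L"
  proof -
    have "0 \<le> L * l1_dist (axis K_O 1) 0" using \<phi>(3) order_trans[OF abs_ge_zero] by blast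
    then show ?thesis by (simp add: l1_dist_def sum_cls axis_def)
  qed
  have 0: "0 \<le> g s n" for s n
    unfolding g_def using c0 \<phi>(1) \<open>0 < K\<close> by (auto intro!: cINF_greatest add_nonneg_nonneg)
  have 1: "\<bar>g s n\<bar> \<le> 1" for s n using 0[of s n] by (simp add: g_def)
  have "E (real N * t) (g t) \<le> E 0 (g 0) + 18750 * K * t / real N"
    unfolding g_def c_def using assms by (intro inf_convolution_decay) auto
  moreover have "E 0 (g 0) \<le> E 0 (\<lambda>n. \<phi> (?F t (scaled N n)))"
  proof (rule expectation_mono_bounded[OF 1, of _ 1])
    fix n
    have "scaled N n \<in> orthant" by (simp add: orthant_def scaled_def)
    then have "?F 0 (scaled N n) = scaled N n" by (intro fluid_flow_0 scaled_arrivals_0)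
    then have c: "c 0 n (scaled N n) = 0" by (simp add: c_def)
    have "(INF x. \<phi> (?F t x) + K * c 0 n x) \<le> \<phi> (?F t (scaled N n)) + K * c 0 n (scaled N n)"
      by (rule cINF_lower[OF bdd]) simp
    then show "g 0 n \<le> \<phi> (?F t (scaled N n))" unfolding g_def c by simp
  qed (use \<phi> in auto)
  moreover have "E (real N * t) (\<lambda>n. \<phi> (scaled N n) - 45 * L\<^sup>2 / K) \<le> E (real N * t) (g t)"
  proof (rule expectation_mono_bounded[OF _ 1, of _ "1 + 45 * L\<^sup>2 / K"])
    fix n
    have pos: "0 \<le> 45 * L\<^sup>2 / K" using \<open>0 < K\<close> by simp
    then show "\<bar>\<phi> (scaled N n) - 45 * L\<^sup>2 / K\<bar> \<le> 1 + 45 * L\<^sup>2 / K"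
      using \<phi>(1,2)[of "scaled N n"] by (simp add: abs_le_iff)
    have "\<phi> (scaled N n) - 45 * L\<^sup>2 / K \<le> (INF x. \<phi> (?F t x) + K * c t n x)"
    proof (rule cINF_greatest)
      fix x
      \<comment> \<open>Completing the square. A discrepancy \<open>d\<close> in one queue can
        change \<open>\<phi>\<close> by \<open>6 * L * \<bar>d\<bar>\<close>, with 6 from
        \<open>l1_dist_le_queue\<close>; five queues turn 9 into 45.\<close>
      have sq: "6 * L * \<bar>d\<bar> - 9 * L\<^sup>2 / K \<le> K * d\<^sup>2" for d :: real
      proof -
        have "0 \<le> (K * \<bar>d\<bar> - 3 * L)\<^sup>2 / K" using \<open>0 < K\<close> by simp
        also have "\<dots> = K * d\<^sup>2 - 6 * L * \<bar>d\<bar> + 9 * L\<^sup>2 / K"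
          using \<open>0 < K\<close> by (simp add: power2_eq_square field_simps)
        finally show ?thesis by simp
      qed
      let ?d = "\<lambda>i. queue_at N i n - queue i (($) (?F t x))"
      have "\<phi> (scaled N n) - \<phi> (?F t x) \<le> L * (6 * (\<Sum>i\<in>UNIV. \<bar>?d i\<bar>))"
        using order_trans[OF \<phi>(3) mult_left_mono[OF l1_dist_le_queue L], of "scaled N n" "?F t x"]
        by linarith
      also have "\<dots> - 45 * L\<^sup>2 / K = (\<Sum>i\<in>UNIV. 6 * L * \<bar>?d i\<bar> - 9 * L\<^sup>2 / K)"
        by (simp add: sum_subtractf sum_distrib_left CARD_cls mult_ac)
      also have "\<dots> \<le> (\<Sum>i\<in>UNIV. K * (?d i)\<^sup>2)" by (intro sum_mono sq)
      also have "\<dots> = K * c t n x" by (simp add: c_def sum_distrib_left)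
      finally show "\<phi> (scaled N n) - 45 * L\<^sup>2 / K \<le> \<phi> (?F t x) + K * c t n x" by simp
    qed simp
    then show "\<phi> (scaled N n) - 45 * L\<^sup>2 / K \<le> g t n"
      using \<phi>(2)[of "scaled N n"] pos unfolding g_def by simp
  qed
  moreover have "integrable (P (real N * t)) (\<lambda>n. \<phi> (scaled N n))"
    using \<phi> by (intro integrable_pmf_bounded[of _ 1]) auto
  ultimately show ?thesis by simp
qed

end

section \<open>Convergence in the KROV distance\<close>

lemma l1_dist_le_norm: "l1_dist x y \<le> 5 * norm (x - y)"
proof -
  have "l1_dist x y \<le> (\<Sum>a\<in>(UNIV::cls set). norm (x - y))"
    unfolding l1_dist_def
    using component_le_norm_cart[of "x - y"] by (intro sum_mono) (auto simp: vector_minus_component)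
  then show ?thesis by (simp add: CARD_cls)
qed

lemma norm_le_l1_dist: "norm (x - y) \<le> l1_dist x y"
  using norm_le_l1_cart[of "x - y"] by (simp add: l1_dist_def)

lemma component_le_l1_dist: "\<bar>x $ a - y $ a\<bar> \<le> l1_dist x y"
  using component_le_norm_cart[of "x - y" a] norm_le_l1_dist[of x y] by (simp add: vector_minus_component)

lemma l1_dist_nonneg: "0 \<le> l1_dist x y"
  by (simp add: l1_dist_def sum_nonneg)

lemma continuous_if_l1_lipschitz:
  fixes \<phi> :: "pt \<Rightarrow> real"
  assumes "\<And>x y. \<bar>\<phi> x - \<phi> y\<bar> \<le> L * l1_dist x y" "0 \<le> L"
  shows "continuous_on UNIV \<phi>"
proof -
  have "(5 * L)-lipschitz_on UNIV \<phi>"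
  proof (rule lipschitz_onI)
    show "dist (\<phi> x) (\<phi> y) \<le> 5 * L * dist x y" for x y
      using order_trans[OF assms(1) mult_left_mono[OF l1_dist_le_norm assms(2)], of x y]
      by (simp add: dist_real_def dist_norm mult.assoc mult.left_commute)
  qed (use assms in simp)
  then show ?thesis by (rule lipschitz_on_continuous_on)
qed

lemma borel_measurable_if_l1_lipschitz:
  fixes \<phi> :: "pt \<Rightarrow> real"
  assumes "\<And>x y. \<bar>\<phi> x - \<phi> y\<bar> \<le> L * l1_dist x y" "0 \<le> L"
  shows "\<phi> \<in> borel_measurable borel"
  by (intro borel_measurable_continuous_onI continuous_if_l1_lipschitz[of \<phi> L] assms)

lemma integrable_if_l1_lipschitz:
  fixes \<phi> :: "pt \<Rightarrow> real"
  assumes "prob_space M" "sets M = sets borel"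
    and "\<And>x y. \<bar>\<phi> x - \<phi> y\<bar> \<le> L * l1_dist x y" "\<And>x. 0 \<le> \<phi> x" "\<And>x. \<phi> x \<le> 1"
  shows "integrable M \<phi>"
proof -
  interpret prob_space M by fact
  have "\<bar>\<phi> x - \<phi> y\<bar> \<le> \<bar>L\<bar> * l1_dist x y" for x y
    by (rule order_trans[OF assms(3) mult_right_mono[OF _ l1_dist_nonneg]]) simp
  then have "\<phi> \<in> borel_measurable borel"
    by (rule borel_measurable_if_l1_lipschitz) simp
  then have "\<phi> \<in> borel_measurable M"
    unfolding measurable_cong_sets[OF assms(2) refl] .
  then show ?thesis
    using assms(4,5) by (intro integrable_const_bound[of _ 1]) simp_all
qed

lemma couplings_measurable:
  assumes "G \<in> couplings M M'"
  shows "fst \<in> borel_measurable G" "snd \<in> borel_measurable G"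
proof -
  have "sets G = sets (borel \<Otimes>\<^sub>M borel)" using assms by (simp add: couplings_def)
  note eq = measurable_cong_sets[OF this refl]
  show "fst \<in> borel_measurable G" "snd \<in> borel_measurable G"
    unfolding eq by (rule measurable_fst measurable_snd)+
qed

text \<open>A coupling of finite cost carries integrability from one marginal to the other. In this
  way the particle system acquires first moments at positive times, which are not among the
  assumptions.\<close>

lemma krov_integrable:
  fixes \<phi> :: "pt \<Rightarrow> real"
  assumes "krov M M' < \<infinity>" and lip: "\<And>x y. \<bar>\<phi> x - \<phi> y\<bar> \<le> l1_dist x y" and "integrable M' \<phi>"
  shows "integrable M \<phi>"
proof -
  have [measurable]: "\<phi> \<in> borel_measurable borel"
    using lip by (intro borel_measurable_if_l1_lipschitz[of \<phi> 1]) auto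
  obtain G where G: "G \<in> couplings M M'"
    and fin: "(\<integral>\<^sup>+ p. ennreal (l1_dist (fst p) (snd p)) \<partial>G) < \<infinity>"
    using assms(1) unfolding krov_def INF_less_iff by (elim bexE)
  note [measurable] = couplings_measurable[OF G]
  have M: "distr G borel fst = M" "distr G borel snd = M'" using G by (auto simp: couplings_def)
  have "integrable G (\<lambda>p. \<phi> (fst p) - \<phi> (snd p))"
  proof (rule integrableI_bounded)
    have "(\<integral>\<^sup>+ p. ennreal (norm (\<phi> (fst p) - \<phi> (snd p))) \<partial>G)
        \<le> (\<integral>\<^sup>+ p. ennreal (l1_dist (fst p) (snd p)) \<partial>G)"
      using lip by (intro nn_integral_mono ennreal_leI) auto
    then show "(\<integral>\<^sup>+ p. ennreal (norm (\<phi> (fst p) - \<phi> (snd p))) \<partial>G) < \<infinity>"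
      using fin by (rule order_le_less_trans)
  qed measurable
  moreover have "integrable G (\<lambda>p. \<phi> (snd p))"
    using \<open>integrable M' \<phi>\<close> unfolding M(2)[symmetric] by (subst (asm) integrable_distr_eq) auto
  ultimately have "integrable G (\<lambda>p. (\<phi> (fst p) - \<phi> (snd p)) + \<phi> (snd p))"
    by (rule Bochner_Integration.integrable_add)
  then show ?thesis unfolding M(1)[symmetric] by (subst integrable_distr_eq) auto
qed

text \<open>The easy half of Kantorovich-Rubinstein duality: every coupling gives the bound, so no
  optimal one has to exist.\<close>

lemma krov_contraction:
  fixes \<phi> :: "pt \<Rightarrow> real"
  assumes lip: "\<And>x y. \<bar>\<phi> x - \<phi> y\<bar> \<le> l1_dist x y" and int: "integrable M \<phi>" "integrable M' \<phi>"
  shows "ennreal \<bar>integral\<^sup>L M \<phi> - integral\<^sup>L M' \<phi>\<bar> \<le> krov M M'"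
  unfolding krov_def
proof (rule INF_greatest)
  fix G assume G: "G \<in> couplings M M'"
  have [measurable]: "\<phi> \<in> borel_measurable borel"
    using lip by (intro borel_measurable_if_l1_lipschitz[of \<phi> 1]) auto
  note [measurable] = couplings_measurable[OF G]
  have M: "distr G borel fst = M" "distr G borel snd = M'" using G by (auto simp: couplings_def)
  have i: "integrable G (\<lambda>p. \<phi> (fst p))" "integrable G (\<lambda>p. \<phi> (snd p))"
    using int unfolding M[symmetric] by (auto simp: integrable_distr_eq)
  have "integral\<^sup>L M \<phi> = (\<integral>p. \<phi> (fst p) \<partial>G)" "integral\<^sup>L M' \<phi> = (\<integral>p. \<phi> (snd p) \<partial>G)"
    unfolding M[symmetric] by (simp_all add: integral_distr)
  then have "integral\<^sup>L M \<phi> - integral\<^sup>L M' \<phi> = (\<integral>p. \<phi> (fst p) - \<phi> (snd p) \<partial>G)"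
    using i by simp
  then have "ennreal \<bar>integral\<^sup>L M \<phi> - integral\<^sup>L M' \<phi>\<bar>
      = ennreal (norm (\<integral>p. \<phi> (fst p) - \<phi> (snd p) \<partial>G))" by simp
  also have "ennreal (norm (\<integral>p. \<phi> (fst p) - \<phi> (snd p) \<partial>G))
      \<le> (\<integral>\<^sup>+ p. ennreal (norm (\<phi> (fst p) - \<phi> (snd p))) \<partial>G)"
    using i by (intro integral_norm_bound_ennreal) auto
  also have "\<dots> \<le> (\<integral>\<^sup>+ p. ennreal (l1_dist (fst p) (snd p)) \<partial>G)"
    using lip by (intro nn_integral_mono ennreal_leI) (simp only: real_norm_def)
  finally show "ennreal \<bar>integral\<^sup>L M \<phi> - integral\<^sup>L M' \<phi>\<bar>
      \<le> (\<integral>\<^sup>+ p. ennreal (l1_dist (fst p) (snd p)) \<partial>G)" .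
qed

text \<open>Only the limit is assumed to integrate \<open>\<phi>\<close>; along the sequence
  integrability begins once the distance is finite. Boundedness of \<open>\<phi>\<close> is not
  assumed, so coordinates are admissible.\<close>

lemma krov_tendsto_integral:
  fixes \<phi> :: "pt \<Rightarrow> real"
  assumes krov: "(\<lambda>j. krov (M j) M') \<longlonglongrightarrow> 0"
    and lip: "\<And>x y. \<bar>\<phi> x - \<phi> y\<bar> \<le> L * l1_dist x y" and int: "integrable M' \<phi>"
  shows "\<forall>\<^sub>F j in sequentially. integrable (M j) \<phi>" "(\<lambda>j. integral\<^sup>L (M j) \<phi>) \<longlonglongrightarrow> integral\<^sup>L M' \<phi>"
proof -
  define L' where "L' = \<bar>L\<bar> + 1"
  have L': "L' > 0" by (simp add: L'_def)
  define \<psi> where "\<psi> = (\<lambda>x. \<phi> x / L')"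
  have \<psi>: "\<bar>\<psi> x - \<psi> y\<bar> \<le> l1_dist x y" for x y
  proof -
    have "\<bar>\<phi> x - \<phi> y\<bar> \<le> L' * l1_dist x y"
      by (rule order_trans[OF lip mult_right_mono[OF _ l1_dist_nonneg]]) (simp add: L'_def)
    moreover have "\<psi> x - \<psi> y = (\<phi> x - \<phi> y) / L'"
      unfolding \<psi>_def by (rule diff_divide_distrib[symmetric])
    ultimately show ?thesis using L' by (simp add: abs_divide pos_divide_le_eq mult.commute[of _ L'])
  qed
  have int': "integrable M' \<psi>" using int by (simp add: \<psi>_def)
  have "\<forall>\<^sub>F j in sequentially. krov (M j) M' < \<infinity>"
    using order_tendstoD(2)[OF krov, of \<infinity>] by simp
  then have ev: "\<forall>\<^sub>F j in sequentially. integrable (M j) \<psi>"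
    by eventually_elim (rule krov_integrable[where \<phi> = \<psi> and M' = M', OF _ _ int'], simp_all add: \<psi>)
  have \<phi>: "\<phi> = (\<lambda>x. L' * \<psi> x)" using L' by (simp add: \<psi>_def fun_eq_iff)
  from ev show "\<forall>\<^sub>F j in sequentially. integrable (M j) \<phi>"
    unfolding \<phi> by eventually_elim (rule integrable_mult_right)
  have "(\<lambda>j. ennreal \<bar>integral\<^sup>L (M j) \<psi> - integral\<^sup>L M' \<psi>\<bar>) \<longlonglongrightarrow> ennreal 0"
  proof (rule tendsto_sandwich[OF _ _ tendsto_const])
    show "(\<lambda>j. krov (M j) M') \<longlonglongrightarrow> ennreal 0" using krov by simp
    show "\<forall>\<^sub>F j in sequentially. ennreal \<bar>integral\<^sup>L (M j) \<psi> - integral\<^sup>L M' \<psi>\<bar> \<le> krov (M j) M'"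
      using ev by eventually_elim (rule krov_contraction[where \<phi> = \<psi> and M' = M', OF _ _ int'], simp_all add: \<psi>)
  qed simp
  then have "(\<lambda>j. \<bar>integral\<^sup>L (M j) \<psi> - integral\<^sup>L M' \<psi>\<bar>) \<longlonglongrightarrow> 0"
    by (subst (asm) tendsto_ennreal_iff) auto
  then have "(\<lambda>j. integral\<^sup>L (M j) \<psi>) \<longlonglongrightarrow> integral\<^sup>L M' \<psi>"
    by (rule LIM_zero_cancel[OF tendsto_rabs_zero_cancel])
  then show "(\<lambda>j. integral\<^sup>L (M j) \<phi>) \<longlonglongrightarrow> integral\<^sup>L M' \<phi>"
    unfolding \<phi> by (simp add: tendsto_mult_left)
qed

text \<open>The test class is stable under \<open>\<phi>\<close> to \<open>1 - \<phi>\<close>, which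
  turns the inequality into an equality. Its members decrease to indicators of closed sets, and
  these sets form an intersection-stable generator of the Borel sets.\<close>

lemma prob_measure_eqI_l1_lipschitz:
  fixes M M' :: "pt measure"
  assumes M: "prob_space M" "sets M = sets borel" and M': "prob_space M'" "sets M' = sets borel"
    and le: "\<And>\<phi> L. (\<And>x. 0 \<le> \<phi> x) \<Longrightarrow> (\<And>x. \<phi> x \<le> 1) \<Longrightarrow>
      (\<And>x y. \<bar>\<phi> x - \<phi> y\<bar> \<le> L * l1_dist x y) \<Longrightarrow> integral\<^sup>L M \<phi> \<le> integral\<^sup>L M' \<phi>"
  shows "M = M'"
proof -
  interpret M: prob_space M by fact
  interpret M': prob_space M' by fact
  \<comment> \<open>The empty set is excluded because \<open>infdist\<close> to it is 0 by
    convention, which would make every \<open>\<phi> k\<close> equal to 1.\<close>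
  have closed_eq: "measure M C = measure M' C" if C: "closed C" "C \<noteq> {}" for C
  proof -
    define \<phi> where "\<phi> = (\<lambda>(k::nat) x. max 0 (1 - real k * infdist x C))"
    have \<phi>: "0 \<le> \<phi> k x" "\<phi> k x \<le> 1" for k x
      using infdist_nonneg[of x C] by (auto simp: \<phi>_def)
    have lip: "\<bar>\<phi> k x - \<phi> k y\<bar> \<le> real k * l1_dist x y" for k x y
    proof -
      have "\<bar>infdist x C - infdist y C\<bar> \<le> l1_dist x y"
        using infdist_triangle_abs[of x C y] norm_le_l1_dist[of x y] by (simp add: dist_norm)
      then have "\<bar>real k * infdist x C - real k * infdist y C\<bar> \<le> real k * l1_dist x y"
        unfolding right_diff_distrib[symmetric] abs_mult by (simp add: mult_left_mono)
      then show ?thesis unfolding \<phi>_def by linarith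
    qed
    have meas: "\<phi> k \<in> borel_measurable borel" for k
      using lip by (intro borel_measurable_if_l1_lipschitz[of _ "real k"]) auto
    have lim: "(\<lambda>k. \<phi> k x) \<longlonglongrightarrow> indicator C x" for x
    proof (cases "x \<in> C")
      case False
      then have pos: "infdist x C > 0" using C infdist_pos_not_in_closed by blast
      obtain m :: nat where m: "1 < real m * infdist x C"
        using reals_Archimedean3[OF pos] by blast
      show ?thesis
      proof (rule tendsto_eventually)
        show "\<forall>\<^sub>F k in sequentially. \<phi> k x = indicator C x"
          using eventually_ge_at_top[of m]
        proof eventually_elim
          case (elim k)
          have "real m * infdist x C \<le> real k * infdist x C"
            using elim by (intro mult_right_mono infdist_nonneg) auto
          then show ?case using m False by (simp add: \<phi>_def)
        qed
      qed
    qed (simp add: \<phi>_def)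
    have E: "(\<lambda>k. integral\<^sup>L Q (\<phi> k)) \<longlonglongrightarrow> measure Q C" if "prob_space Q" "sets Q = sets borel" for Q
    proof -
      interpret Q: prob_space Q by fact
      have "C \<in> sets Q" using C that by simp
      moreover have "(\<lambda>k. integral\<^sup>L Q (\<phi> k)) \<longlonglongrightarrow> integral\<^sup>L Q (indicator C)"
        using \<phi> lim meas C by (intro integral_dominated_convergence[where w = "\<lambda>_. 1"])
          (auto simp: measurable_cong_sets[OF that(2) refl])
      ultimately show ?thesis by simp
    qed
    have "integral\<^sup>L M (\<phi> k) \<le> integral\<^sup>L M' (\<phi> k)" for k
      using \<phi> lip by (intro le[of _ "real k"])
    moreover have "integral\<^sup>L M' (\<phi> k) \<le> integral\<^sup>L M (\<phi> k)" for k
    proof -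
      have "integral\<^sup>L M (\<lambda>x. 1 - \<phi> k x) \<le> integral\<^sup>L M' (\<lambda>x. 1 - \<phi> k x)"
        using \<phi> lip by (intro le[of _ "real k"]) (auto simp: abs_minus_commute)
      moreover have "integrable M (\<phi> k)" by (rule integrable_if_l1_lipschitz[OF M lip \<phi>])
      moreover have "integrable M' (\<phi> k)" by (rule integrable_if_l1_lipschitz[OF M' lip \<phi>])
      ultimately show ?thesis by (simp add: M.prob_space M'.prob_space)
    qed
    ultimately have "integral\<^sup>L M (\<phi> k) = integral\<^sup>L M' (\<phi> k)" for k
      by (rule antisym)
    then have "(\<lambda>k. integral\<^sup>L M' (\<phi> k)) \<longlonglongrightarrow> measure M C"
      using E[OF M] by simp
    then show ?thesis using E[OF M'] by (rule LIMSEQ_unique)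
  qed
  show ?thesis
  proof (rule measure_eqI_generator_eq[where \<Omega> = UNIV and E = "Collect closed" and A = "\<lambda>_. UNIV"])
    show "emeasure M X = emeasure M' X" if "X \<in> Collect closed" for X
      unfolding M.emeasure_eq_measure M'.emeasure_eq_measure
      using closed_eq[of X] that by (cases "X = {}") simp_all
    show "sets M = sigma_sets UNIV (Collect closed)" "sets M' = sigma_sets UNIV (Collect closed)"
      unfolding M(2) M'(2) borel_eq_closed by (simp_all add: sets_measure_of)
    show "emeasure M UNIV \<noteq> \<infinity>" by simp
  qed (auto intro: Int_stableI)
qed

section \<open>From measures on the lattice to mass functions of counts\<close>

lemma inj_scaled: "0 < N \<Longrightarrow> inj (scaled N)"
  by (auto simp: inj_def scaled_def vec_eq_iff fun_eq_iff)

text \<open>A measure carried by a countable set is the sum of its point masses; positive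
  \<open>N\<close> keeps distinct counts at distinct points, so no mass is counted twice.\<close>

lemma lattice_pmf:
  assumes "prob_on (lattice N) M" "0 < N"
  shows "\<exists>p. (\<forall>n. pmf p n = mass N M n) \<and> M = distr (measure_pmf p) borel (scaled N)"
proof -
  interpret prob_space M using assms by (simp add: prob_on_def)
  have sets: "sets M = sets borel" and AE: "AE x in M. x \<in> lattice N"
    using assms by (auto simp: prob_on_def)
  have restr: "emeasure M A = (\<integral>\<^sup>+n. ennreal (mass N M n) \<partial>count_space {n. scaled N n \<in> A})"
    if A: "A \<in> sets borel" for A
  proof -
    have "emeasure M A = emeasure M (\<Union>n\<in>{n. scaled N n \<in> A}. {scaled N n})"
    proof (rule emeasure_eq_AE)
      show "AE x in M. x \<in> A \<longleftrightarrow> x \<in> (\<Union>n\<in>{n. scaled N n \<in> A}. {scaled N n})"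
        using AE by eventually_elim (auto simp: lattice_def)
      show "(\<Union>n\<in>{n. scaled N n \<in> A}. {scaled N n}) \<in> sets M"
        by (intro sets.countable_UN'') (auto simp: sets)
    qed (simp add: A sets)
    also have "\<dots> = (\<integral>\<^sup>+n. emeasure M {scaled N n} \<partial>count_space {n. scaled N n \<in> A})"
      using inj_scaled[OF assms(2)]
      by (intro emeasure_UN_countable) (auto simp: sets disjoint_family_on_def inj_def)
    finally show ?thesis by (simp add: mass_def emeasure_eq_measure)
  qed
  have one: "(\<integral>\<^sup>+n. ennreal (mass N M n) \<partial>count_space UNIV) = 1"
    using restr[of UNIV] emeasure_space_1 sets_eq_imp_space_eq[OF sets] by simp
  define p where "p = embed_pmf (mass N M)"
  have p: "pmf p n = mass N M n" for n
    unfolding p_def using one by (intro pmf_embed_pmf) (auto simp: mass_def)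
  have "M = distr (measure_pmf p) borel (scaled N)"
  proof (rule measure_eqI)
    fix A assume "A \<in> sets M"
    then have A: "A \<in> sets borel" by (simp add: sets)
    have "emeasure (distr (measure_pmf p) borel (scaled N)) A = emeasure (measure_pmf p) {n. scaled N n \<in> A}"
      using A by (subst emeasure_distr) (auto simp: vimage_def)
    also have "\<dots> = (\<integral>\<^sup>+n. ennreal (pmf p n) \<partial>count_space {n. scaled N n \<in> A})"
      by (rule nn_integral_pmf[symmetric])
    finally show "emeasure M A = emeasure (distr (measure_pmf p) borel (scaled N)) A"
      using restr[OF A] by (simp add: p)
  qed (simp add: sets)
  with p show ?thesis by (intro exI[of _ p]) simp
qed

lemma outflow_rate_eq:
  assumes "\<And>n. pmf p n = mass N M n"
  shows "outflow_rate N M a = outflow p a"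
proof -
  have "Infinite_Set_Sum.abs_summable_on (\<lambda>n. pmf p n * service a n) UNIV"
  proof (rule Infinite_Set_Sum.abs_summable_on_comparison_test)
    show "Infinite_Set_Sum.abs_summable_on (\<lambda>n. 10 * pmf p n) UNIV"
      by (intro Infinite_Set_Sum.abs_summable_on_cmult_right pmf_abs_summable)
    show "norm (pmf p n * service a n) \<le> norm (10 * pmf p n)" for n
      using service_nonneg[of a n] mult_left_mono[OF service_le, of "pmf p n" a n] by (simp add: abs_mult)
  qed
  then have "outflow p a = (\<Sum>\<^sub>\<infinity>n. pmf p n * service a n)"
    unfolding outflow_def pmf_expectation_eq_infsetsum by (rule infsetsum_infsum)
  then show ?thesis by (simp add: outflow_rate_def assms mult.commute)
qed

lemma inflow_rate_eq:
  assumes "\<And>n. pmf p n = mass N M n"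
  shows "inflow_rate N M a = inflow p a"
  by (cases a) (simp_all add: outflow_rate_eq[OF assms])

lemma nlmp_evolution_network:
  assumes "nlmp_evolution N \<nu>" "0 < N"
  shows "\<exists>P. network P \<and> (\<forall>t\<ge>0. \<nu> t = distr (measure_pmf (P t)) borel (scaled N))"
proof -
  define P where "P t = (SOME p. (\<forall>n. pmf p n = mass N (\<nu> t) n)
    \<and> \<nu> t = distr (measure_pmf p) borel (scaled N))" for t
  have P: "pmf (P t) n = mass N (\<nu> t) n" "\<nu> t = distr (measure_pmf (P t)) borel (scaled N)"
    if "0 \<le> t" for t n
  proof -
    have "prob_on (lattice N) (\<nu> t)" using assms(1) that by (simp add: nlmp_evolution_def)
    from someI_ex[OF lattice_pmf[OF this assms(2)], folded P_def]
    show "pmf (P t) n = mass N (\<nu> t) n" "\<nu> t = distr (measure_pmf (P t)) borel (scaled N)" by auto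
  qed
  have "network P"
  proof
    fix t :: real and n assume t: "0 \<le> t"
    have "((\<lambda>s. mass N (\<nu> s) n) has_real_derivative generator N (\<nu> t) n) (at t within {0..})"
      using assms t by (simp add: nlmp_evolution_def)
    \<comment> \<open>\<open>P\<close> is tied to \<open>\<nu>\<close> at nonnegative times only;
      the derivative within \<open>{0..}\<close> never sees the arbitrary values elsewhere.\<close>
    then have "((\<lambda>s. pmf (P s) n) has_real_derivative generator N (\<nu> t) n) (at t within {0..})"
      by (rule has_field_derivative_transform_within[of _ _ _ _ 1]) (use t P(1) in auto)
    moreover have "generator N (\<nu> t) n = - pmf (P t) n * (\<Sum>a\<in>UNIV. inflow (P t) a + service a n)
      + (\<Sum>a\<in>UNIV. if n a = 0 then 0 else pmf (P t) (depart a n) * inflow (P t) a)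
      + (\<Sum>a\<in>UNIV. pmf (P t) (arrive a n) * service a (arrive a n))"
      unfolding generator_def inflow_rate_eq[OF P(1)[OF t]] P(1)[OF t] ..
    ultimately show "((\<lambda>s. pmf (P s) n) has_real_derivative
      - pmf (P t) n * (\<Sum>a\<in>UNIV. inflow (P t) a + service a n)
      + (\<Sum>a\<in>UNIV. if n a = 0 then 0 else pmf (P t) (depart a n) * inflow (P t) a)
      + (\<Sum>a\<in>UNIV. pmf (P t) (arrive a n) * service a (arrive a n))) (at t within {0..})"
      by simp
  qed
  then show ?thesis using P(2) by (intro exI[of _ P]) simp
qed

section \<open>The fluid limit\<close>

lemma inflow_bdd_below: "inflow_on T Y \<Longrightarrow> t \<le> T \<Longrightarrow> bdd_below (Y a ` {0..t})"
  by (auto simp: inflow_on_def intro: lipschitz_bdd_below)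

lemma fluid_flow_lipschitz:
  assumes "inflow_on T Y" "t \<in> {0..T}"
  shows "l1_dist (fluid_flow Y t x) (fluid_flow Y t y) \<le> 300 * l1_dist x y"
  using fluid_flow_diff[of Y t Y 0 x y] inflow_bdd_below[OF assms(1)] assms(2) by simp

lemma fluid_flow_component_lipschitz:
  assumes "inflow_on T Y" "t \<in> {0..T}"
  shows "\<bar>fluid_flow Y t x $ a - fluid_flow Y t y $ a\<bar> \<le> 300 * l1_dist x y"
  using component_le_l1_dist fluid_flow_lipschitz[OF assms] by (rule order_trans)

lemma fluid_flow_measurable:
  assumes "inflow_on T Y" "t \<in> {0..T}"
  shows "fluid_flow Y t \<in> borel_measurable borel"
proof -
  have "continuous_on UNIV (\<lambda>x. fluid_flow Y t x $ a)" for a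
    using fluid_flow_component_lipschitz[OF assms] by (intro continuous_if_l1_lipschitz[of _ 300]) auto
  then have "continuous_on UNIV (\<lambda>x. \<chi> a. fluid_flow Y t x $ a)"
    by (intro continuous_on_vec_lambda)
  then show ?thesis by (intro borel_measurable_continuous_onI) (simp add: vec_lambda_eta)
qed

lemma le_if_le_add_small_multiples:
  fixes x y c :: real
  assumes "\<And>\<eta>. 0 < \<eta> \<Longrightarrow> x \<le> y + c * \<eta>"
  shows "x \<le> y"
proof (rule field_le_epsilon)
  fix e :: real assume "0 < e"
  then have "0 < e / (\<bar>c\<bar> + 1)" by simp
  from assms[OF this] have "x \<le> y + c / (\<bar>c\<bar> + 1) * e" by simp
  also have "c / (\<bar>c\<bar> + 1) * e \<le> 1 * e"
    using \<open>0 < e\<close> by (intro mult_right_mono) (auto simp: divide_le_eq)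
  finally show "x \<le> y + e" by simp
qed

text \<open>Two limits in order: for fixed \<open>\<eta>\<close> the penalty is
  \<open>1 / \<eta>\<close> and \<open>N j\<close> tends to infinity, then \<open>\<eta>\<close>
  tends to 0. The same \<open>\<eta>\<close> measures the distance between the scaled arrivals and
  \<open>Y\<close>.\<close>

lemma fluid_limit:
  assumes N: "filterlim N at_top sequentially" "\<And>j. 0 < N j"
    and net: "\<And>j. network (Q j)"
    and Y: "inflow_on T Y" and t: "t \<in> {0..T}"
    and unif: "\<And>e. 0 < e \<Longrightarrow> \<forall>\<^sub>F j in sequentially. \<forall>a. \<forall>s\<in>{0..T}.
      \<bar>network.scaled_arrivals (Q j) (N j) a s - Y a s\<bar> \<le> e"
    and \<mu>\<^sub>0: "prob_space \<mu>\<^sub>0" "sets \<mu>\<^sub>0 = sets borel" and \<mu>: "prob_space \<mu>" "sets \<mu> = sets borel"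
    and krov_0: "(\<lambda>j. krov (distr (Q j 0) borel (scaled (N j))) \<mu>\<^sub>0) \<longlonglongrightarrow> 0"
    and krov_t: "(\<lambda>j. krov (distr (Q j (real (N j) * t)) borel (scaled (N j))) \<mu>) \<longlonglongrightarrow> 0"
  shows "\<mu> = distr \<mu>\<^sub>0 borel (fluid_flow Y t)"
proof (rule prob_measure_eqI_l1_lipschitz[OF \<mu>])
  have F: "fluid_flow Y t \<in> borel_measurable borel" by (rule fluid_flow_measurable[OF Y t])
  then have F': "fluid_flow Y t \<in> borel_measurable \<mu>\<^sub>0" by (simp add: measurable_cong_sets[OF \<mu>\<^sub>0(2) refl])
  show "prob_space (distr \<mu>\<^sub>0 borel (fluid_flow Y t))" by (rule prob_space.prob_space_distr[OF \<mu>\<^sub>0(1) F'])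
  fix \<phi> :: "pt \<Rightarrow> real" and L
  assume \<phi>: "\<And>x. 0 \<le> \<phi> x" "\<And>x. \<phi> x \<le> 1" and lip': "\<And>x y. \<bar>\<phi> x - \<phi> y\<bar> \<le> L * l1_dist x y"
  define L' where "L' = \<bar>L\<bar>"
  have L': "0 \<le> L'" by (simp add: L'_def)
  have lip: "\<bar>\<phi> x - \<phi> y\<bar> \<le> L' * l1_dist x y" for x y
    by (rule order_trans[OF lip' mult_right_mono[OF _ l1_dist_nonneg]]) (simp add: L'_def)
  have \<phi>_meas: "\<phi> \<in> borel_measurable borel" by (rule borel_measurable_if_l1_lipschitz[OF lip L'])
  define \<psi> where "\<psi> = (\<lambda>x. \<phi> (fluid_flow Y t x))"
  have \<psi>_lip: "\<bar>\<psi> x - \<psi> y\<bar> \<le> (300 * L') * l1_dist x y" for x y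
    unfolding \<psi>_def using order_trans[OF lip mult_left_mono[OF fluid_flow_lipschitz[OF Y t] L']]
    by (simp add: mult.assoc mult.left_commute)
  have \<psi>_meas: "\<psi> \<in> borel_measurable borel"
    using L' by (intro borel_measurable_if_l1_lipschitz[OF \<psi>_lip]) simp
  have int: "integrable \<mu> \<phi>" "integrable \<mu>\<^sub>0 \<psi>"
    using integrable_if_l1_lipschitz[OF \<mu> lip \<phi>]
      integrable_if_l1_lipschitz[OF \<mu>\<^sub>0 \<psi>_lip] \<phi> by (simp_all add: \<psi>_def)
  define a where "a = (\<lambda>j. measure_pmf.expectation (Q j (real (N j) * t)) (\<lambda>n. \<phi> (scaled (N j) n)))"
  define b where "b = (\<lambda>j. measure_pmf.expectation (Q j 0) (\<lambda>n. \<psi> (scaled (N j) n)))"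
  have a_lim: "a \<longlonglongrightarrow> integral\<^sup>L \<mu> \<phi>"
    using krov_tendsto_integral(2)[OF krov_t lip int(1)] \<phi>_meas by (simp add: a_def integral_distr)
  have b_lim: "b \<longlonglongrightarrow> integral\<^sup>L \<mu>\<^sub>0 \<psi>"
    using krov_tendsto_integral(2)[OF krov_0 \<psi>_lip int(2)] \<psi>_meas by (simp add: b_def integral_distr)
  have "integral\<^sup>L \<mu> \<phi> \<le> integral\<^sup>L \<mu>\<^sub>0 \<psi>"
  \<comment> \<open>The first summand pays for replacing the arrivals by \<open>Y\<close>, with 1500
    = 300 * 5 from \<open>fluid_flow_diff\<close>; the second is the error of the penalty
    \<open>1 / \<eta>\<close>.\<close>
  proof (rule le_if_le_add_small_multiples[of _ _ "L' * 1500 + 45 * L'\<^sup>2"])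
    fix \<eta> :: real assume \<eta>: "0 < \<eta>"
    have "\<forall>\<^sub>F j in sequentially. a j \<le> b j + L' * (1500 * \<eta>) + 45 * L'\<^sup>2 * \<eta>
        + 18750 * (1 / \<eta>) * t / real (N j)"
      using unif[OF \<eta>]
    proof eventually_elim
      case (elim j)
      interpret network "Q j" by (rule net)
      have "\<phi> (fluid_flow (scaled_arrivals (N j)) t x) \<le> \<psi> x + L' * (1500 * \<eta>)" for x
      proof -
        have "l1_dist (fluid_flow (scaled_arrivals (N j)) t x) (fluid_flow Y t x)
            \<le> 300 * (l1_dist x x + 5 * \<eta>)"
          using elim t scaled_arrivals_bdd_below inflow_bdd_below[OF Y] by (intro fluid_flow_diff) auto
        also have "l1_dist x x = 0" by (simp add: l1_dist_def)
        finally have "L' * l1_dist (fluid_flow (scaled_arrivals (N j)) t x) (fluid_flow Y t x)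
            \<le> L' * (1500 * \<eta>)" using L' by (intro mult_left_mono) auto
        then show ?thesis
          using lip[of "fluid_flow (scaled_arrivals (N j)) t x" "fluid_flow Y t x"]
          unfolding \<psi>_def by linarith
      qed
      then have "E 0 (\<lambda>n. \<phi> (fluid_flow (scaled_arrivals (N j)) t (scaled (N j) n)))
          \<le> E 0 (\<lambda>n. \<psi> (scaled (N j) n) + L' * (1500 * \<eta>))"
        using \<phi> L' \<eta> by (intro expectation_mono_bounded[of _ 1 _ "1 + L' * (1500 * \<eta>)"])
          (auto simp: \<psi>_def)
      also have "\<dots> = b j + L' * (1500 * \<eta>)"
        using \<phi> by (simp add: b_def integrable_pmf_bounded[of _ 1] \<psi>_def)
      finally show ?case
        using fluid_approximation[of "N j" t "1 / \<eta>" \<phi> L'] N(2)[of j] t \<eta> \<phi> lip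
        unfolding a_def by simp
    qed
    moreover have "(\<lambda>j. b j + L' * (1500 * \<eta>) + 45 * L'\<^sup>2 * \<eta> + 18750 * (1 / \<eta>) * t / real (N j))
        \<longlonglongrightarrow> integral\<^sup>L \<mu>\<^sub>0 \<psi> + L' * (1500 * \<eta>) + 45 * L'\<^sup>2 * \<eta> + 0"
      by (intro tendsto_add b_lim tendsto_const tendsto_divide_0[OF tendsto_const]
          filterlim_at_top_imp_at_infinity filterlim_compose[OF filterlim_real_sequentially N(1)])
    ultimately have "integral\<^sup>L \<mu> \<phi> \<le> integral\<^sup>L \<mu>\<^sub>0 \<psi> + L' * (1500 * \<eta>) + 45 * L'\<^sup>2 * \<eta> + 0"
      by (intro tendsto_le[OF _ _ a_lim]) auto
    then show "integral\<^sup>L \<mu> \<phi> \<le> integral\<^sup>L \<mu>\<^sub>0 \<psi> + (L' * 1500 + 45 * L'\<^sup>2) * \<eta>"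
      by (simp add: algebra_simps)
  qed
  then show "integral\<^sup>L \<mu> \<phi> \<le> integral\<^sup>L (distr \<mu>\<^sub>0 borel (fluid_flow Y t)) \<phi>"
    using F' \<phi>_meas by (simp add: integral_distr \<psi>_def)
qed simp

section \<open>Identification of the limiting inflows through first moments\<close>

lemma finite_first_moment_component:
  assumes "finite_first_moment M" "sets M = sets borel"
  shows "integrable M (\<lambda>x. x $ a)"
proof (rule Bochner_Integration.integrable_bound)
  show "integrable M (\<lambda>x. l1_dist x 0)" using assms by (simp add: finite_first_moment_def)
  have "(\<lambda>x. x $ a) \<in> borel_measurable (borel :: pt measure)"
    using component_le_l1_dist by (intro borel_measurable_if_l1_lipschitz[of _ 1]) auto
  then show "(\<lambda>x. x $ a) \<in> borel_measurable M" by (simp add: measurable_cong_sets[OF assms(2) refl])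
  show "AE x in M. norm (x $ a) \<le> norm (l1_dist x 0)"
    using component_le_l1_dist[of _ a 0] l1_dist_nonneg by simp
qed

text \<open>Departures are an integral of discontinuous service rates, so their limit is not read
  off from the convergence of the laws directly. The balance of first moments expresses them by
  arrivals and means of coordinates, and those means converge because coordinates are
  Lipschitz.\<close>

lemma departures_limit:
  assumes N: "\<And>j. 0 < N j" and net: "\<And>j. network (Q j)" and "0 \<le> t"
    and A: "(\<lambda>j. network.scaled_arrivals (Q j) (N j) a t) \<longlonglongrightarrow> y"
    and int_0: "integrable \<mu>\<^sub>0 (\<lambda>x. x $ a)" and int: "integrable \<mu> (\<lambda>x. x $ a)"
    and krov_0: "(\<lambda>j. krov (distr (Q j 0) borel (scaled (N j))) \<mu>\<^sub>0) \<longlonglongrightarrow> 0"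
    and krov_t: "(\<lambda>j. krov (distr (Q j (real (N j) * t)) borel (scaled (N j))) \<mu>) \<longlonglongrightarrow> 0"
  shows "(\<lambda>j. network.departures (Q j) a (real (N j) * t) / real (N j))
    \<longlonglongrightarrow> y + (\<integral>x. x $ a \<partial>\<mu>\<^sub>0) - (\<integral>x. x $ a \<partial>\<mu>)"
proof -
  have lip: "\<bar>x $ a - y $ a\<bar> \<le> 1 * l1_dist x y" for x y using component_le_l1_dist by simp
  have meas: "(\<lambda>x. x $ a) \<in> borel_measurable (borel :: pt measure)"
    using lip by (intro borel_measurable_if_l1_lipschitz[of _ 1]) auto
  have D: "integral\<^sup>L (distr (measure_pmf p) borel (scaled M)) (\<lambda>x. x $ a)
      = measure_pmf.expectation p (\<lambda>n. real (n a)) / real M"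
    "0 < M \<Longrightarrow> integrable (distr (measure_pmf p) borel (scaled M)) (\<lambda>x. x $ a)
      \<longleftrightarrow> integrable (measure_pmf p) (\<lambda>n. real (n a))" for p M
    using meas by (simp_all add: integral_distr integrable_distr_eq scaled_def divide_inverse)
  note lim_0 = krov_tendsto_integral[OF krov_0 lip int_0] and lim_t = krov_tendsto_integral[OF krov_t lip int]
  have "\<forall>\<^sub>F j in sequentially. network.scaled_arrivals (Q j) (N j) a t
      + integral\<^sup>L (distr (Q j 0) borel (scaled (N j))) (\<lambda>x. x $ a)
      - integral\<^sup>L (distr (Q j (real (N j) * t)) borel (scaled (N j))) (\<lambda>x. x $ a)
      = network.departures (Q j) a (real (N j) * t) / real (N j)"
    using lim_0(1) lim_t(1)
  proof eventually_elim
    case (elim j)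
    interpret network "Q j" by (rule net)
    have "E (real (N j) * t) (\<lambda>n. real (n a)) - E 0 (\<lambda>n. real (n a))
        = arrivals a (real (N j) * t) - departures a (real (N j) * t)"
      using elim N[of j] \<open>0 \<le> t\<close> by (intro first_moment_balance) (simp_all add: D)
    then have "departures a (real (N j) * t) = arrivals a (real (N j) * t) + E 0 (\<lambda>n. real (n a))
        - E (real (N j) * t) (\<lambda>n. real (n a))" by simp
    then show ?case by (simp add: D scaled_arrivals_def add_divide_distrib diff_divide_distrib)
  qed
  moreover have "(\<lambda>j. network.scaled_arrivals (Q j) (N j) a t
      + integral\<^sup>L (distr (Q j 0) borel (scaled (N j))) (\<lambda>x. x $ a)
      - integral\<^sup>L (distr (Q j (real (N j) * t)) borel (scaled (N j))) (\<lambda>x. x $ a))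
    \<longlonglongrightarrow> y + (\<integral>x. x $ a \<partial>\<mu>\<^sub>0) - (\<integral>x. x $ a \<partial>\<mu>)"
    by (intro tendsto_add tendsto_diff A lim_0(2) lim_t(2))
  ultimately show ?thesis by (rule Lim_transform_eventually[rotated])
qed

text \<open>Arzela-Ascoli with the uniform Lipschitz bound and the common value 0 at time 0. Packing
  the classes into one vector makes a single extraction serve all of them, with constant 100 = 5 *
  20.\<close>

lemma scaled_arrivals_subsequence:
  assumes net: "\<And>j. network (Q j)" and "0 \<le> T"
  shows "\<exists>\<rho> Y. strict_mono (\<rho> :: nat \<Rightarrow> nat) \<and> inflow_on T Y \<and>
    (\<forall>e>0. \<forall>\<^sub>F j in sequentially. \<forall>a. \<forall>s\<in>{0..T}.
      \<bar>network.scaled_arrivals (Q (\<rho> j)) (N (\<rho> j)) a s - Y a s\<bar> \<le> e)"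
proof -
  define A where "A = (\<lambda>j s. (\<chi> a. network.scaled_arrivals (Q j) (N j) a s) :: pt)"
  have lip: "20-lipschitz_on {0..T} (\<lambda>s. A j s $ a)" for j a
    using network.scaled_arrivals_lipschitz[OF net] by (simp add: A_def)
  have zero: "A j 0 = 0" for j
    using network.scaled_arrivals_0[OF net] by (simp add: A_def vec_eq_iff)
  have dist: "norm (A j s - A j u) \<le> 100 * \<bar>s - u\<bar>" if "s \<in> {0..T}" "u \<in> {0..T}" for j s u
  proof -
    have "norm (A j s - A j u) \<le> (\<Sum>a\<in>UNIV. \<bar>(A j s - A j u) $ a\<bar>)" by (rule norm_le_l1_cart)
    also have "\<dots> \<le> (\<Sum>a\<in>(UNIV::cls set). 20 * \<bar>s - u\<bar>)"
      using lipschitz_onD[OF lip that] by (intro sum_mono) (simp add: dist_real_def)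
    finally show ?thesis by (simp add: CARD_cls)
  qed
  obtain g \<rho> where \<rho>: "strict_mono (\<rho> :: nat \<Rightarrow> nat)"
    and g: "\<And>e. 0 < e \<Longrightarrow> \<exists>n. \<forall>j x. n \<le> j \<and> x \<in> {0..T} \<longrightarrow> norm (A (\<rho> j) x - g x) < e"
  proof (rule Arzela_Ascoli[of "{0..T}" A "100 * T"])
    show "norm (A j s) \<le> 100 * T" if "s \<in> {0..T}" for j s
      using dist[OF that, of 0 j] that \<open>0 \<le> T\<close> by (simp add: zero)
    show "\<exists>d>0. \<forall>j u. u \<in> {0..T} \<and> norm (s - u) < d \<longrightarrow> norm (A j s - A j u) < e"
      if "s \<in> {0..T}" "0 < e" for s e
    proof (intro exI[of _ "e / 100"] conjI allI impI)
      fix j u assume "u \<in> {0..T} \<and> norm (s - u) < e / 100"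
      then show "norm (A j s - A j u) < e" using dist[of s u j] that by simp
    qed (use that in simp)
  qed auto
  have conv: "(\<lambda>j. A (\<rho> j) s $ a) \<longlonglongrightarrow> g s $ a" if "s \<in> {0..T}" for s a
  proof -
    have "(\<lambda>j. A (\<rho> j) s) \<longlonglongrightarrow> g s"
      using g that by (intro LIMSEQ_I) blast
    then show ?thesis by (rule tendsto_vec_nth)
  qed
  have "inflow_on T (\<lambda>a s. g s $ a)"
    unfolding inflow_on_def
  proof (intro allI conjI exI[of _ 20])
    fix a
    show "g 0 $ a = 0" using conv[of 0 a] \<open>0 \<le> T\<close> by (simp add: zero LIMSEQ_const_iff)
    show "mono_on {0..T} (\<lambda>s. g s $ a)"
    proof (rule mono_onI)
      fix r s assume rs: "r \<in> {0..T}" "s \<in> {0..T}" "r \<le> s"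
      then have "A (\<rho> j) r $ a \<le> A (\<rho> j) s $ a" for j
        using network.scaled_arrivals_mono[OF net, of r s] by (simp add: A_def)
      then show "g r $ a \<le> g s $ a" using LIMSEQ_le[OF conv[OF rs(1)] conv[OF rs(2)]] by blast
    qed
    show "20-lipschitz_on {0..T} (\<lambda>s. g s $ a)"
    proof (rule lipschitz_onI)
      fix r s assume rs: "r \<in> {0..T}" "s \<in> {0..T}"
      show "dist (g r $ a) (g s $ a) \<le> 20 * dist r s"
        using lipschitz_onD[OF lip rs]
        by (intro LIMSEQ_le_const2[OF tendsto_dist[OF conv[OF rs(1)] conv[OF rs(2)]]]) blast
    qed simp
  qed
  moreover have "\<forall>\<^sub>F j in sequentially. \<forall>a. \<forall>s\<in>{0..T}.
      \<bar>network.scaled_arrivals (Q (\<rho> j)) (N (\<rho> j)) a s - g s $ a\<bar> \<le> e" if e: "0 < e" for e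
  proof -
    obtain n where n: "\<And>j x. n \<le> j \<Longrightarrow> x \<in> {0..T} \<Longrightarrow> norm (A (\<rho> j) x - g x) < e"
      using g[OF e] by blast
    show ?thesis
      using eventually_ge_at_top[of n]
    proof eventually_elim
      case (elim j)
      show ?case
      proof (intro allI ballI)
        fix a s assume "s \<in> {0..T}"
        then show "\<bar>network.scaled_arrivals (Q (\<rho> j)) (N (\<rho> j)) a s - g s $ a\<bar> \<le> e"
          using order_trans[OF component_le_norm_cart less_imp_le[OF n[OF elim]], of s a]
          by (simp add: A_def)
      qed
    qed
  qed
  ultimately show ?thesis using \<rho> by (intro exI[of _ \<rho>] exI[of _ "\<lambda>a s. g s $ a"]) simp
qed

text \<open>The value is the limit found in \<open>departures_limit\<close>, so mean net outflows of
  the fluid are limits of scaled departures.\<close>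

lemma integral_net_outflow:
  assumes Y: "inflow_on T Y" and t: "t \<in> {0..T}" and "prob_space \<mu>\<^sub>0" "sets \<mu>\<^sub>0 = sets borel"
    and int_0: "integrable \<mu>\<^sub>0 (\<lambda>x. x $ a)"
    and \<mu>: "\<mu> = distr \<mu>\<^sub>0 borel (fluid_flow Y t)" and int: "integrable \<mu> (\<lambda>x. x $ a)"
  shows "integrable \<mu>\<^sub>0 (\<lambda>x. net_outflow Y t x a)"
    "(\<integral>x. net_outflow Y t x a \<partial>\<mu>\<^sub>0) = Y a t + (\<integral>x. x $ a \<partial>\<mu>\<^sub>0) - (\<integral>x. x $ a \<partial>\<mu>)"
proof -
  interpret prob_space \<mu>\<^sub>0 by fact
  have F: "fluid_flow Y t \<in> borel_measurable \<mu>\<^sub>0"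
    using fluid_flow_measurable[OF Y t] by (simp add: measurable_cong_sets[OF \<open>sets \<mu>\<^sub>0 = sets borel\<close> refl])
  have meas: "(\<lambda>x. x $ a) \<in> borel_measurable (borel :: pt measure)"
    using component_le_l1_dist by (intro borel_measurable_if_l1_lipschitz[of _ 1]) auto
  have i: "integrable \<mu>\<^sub>0 (\<lambda>x. fluid_flow Y t x $ a)"
    using int F meas unfolding \<mu> by (simp add: integrable_distr_eq)
  have e: "(\<integral>x. x $ a \<partial>\<mu>) = (\<integral>x. fluid_flow Y t x $ a \<partial>\<mu>\<^sub>0)"
    using F meas unfolding \<mu> by (simp add: integral_distr)
  show "integrable \<mu>\<^sub>0 (\<lambda>x. net_outflow Y t x a)"
    unfolding net_outflow_def using i int_0 by auto
  show "(\<integral>x. net_outflow Y t x a \<partial>\<mu>\<^sub>0) = Y a t + (\<integral>x. x $ a \<partial>\<mu>\<^sub>0) - (\<integral>x. x $ a \<partial>\<mu>)"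
    unfolding net_outflow_def e using i int_0 by (simp add: prob_space)
qed

theorem theorem12:
  fixes T :: real
    and \<nu>\<^sub>0 :: "nat \<Rightarrow> pt measure"
    and \<mu>\<^sub>0 :: "pt measure"
    and \<nu> :: "nat \<Rightarrow> real \<Rightarrow> pt measure"
  assumes "T > 0"
    and "\<And>N. N \<ge> 1 \<Longrightarrow> prob_on (lattice N) (\<nu>\<^sub>0 N) \<and> finite_first_moment (\<nu>\<^sub>0 N)"
    and "prob_on orthant \<mu>\<^sub>0" and "finite_first_moment \<mu>\<^sub>0"
    and "(\<lambda>N. krov (\<nu>\<^sub>0 N) \<mu>\<^sub>0) \<longlonglongrightarrow> 0"
    and "\<And>N. N \<ge> 1 \<Longrightarrow> nlmp_evolution N (\<nu> N) \<and> \<nu> N 0 = \<nu>\<^sub>0 N"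
  shows "\<forall>\<mu>. krov_limit_point T (\<lambda>N t. \<nu> N (real N * t)) \<mu>
              \<longrightarrow> fluid_trajectory T \<mu> \<and> \<mu> 0 = \<mu>\<^sub>0"
proof (intro allI impI)
  fix \<mu> assume lim_point: "krov_limit_point T (\<lambda>N t. \<nu> N (real N * t)) \<mu>"
  have prob: "prob_on orthant (\<mu> t)" and moment: "finite_first_moment (\<mu> t)" if "t \<in> {0..T}" for t
    using lim_point that by (auto simp: krov_limit_point_def)
  then have \<mu>: "prob_space (\<mu> t)" "sets (\<mu> t) = sets borel" if "t \<in> {0..T}" for t
    using that by (auto simp: prob_on_def)
  have \<mu>\<^sub>0: "prob_space \<mu>\<^sub>0" "sets \<mu>\<^sub>0 = sets borel" using assms(3) by (auto simp: prob_on_def)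
  obtain \<sigma> where \<sigma>: "strict_mono \<sigma>" "\<And>k. 1 \<le> \<sigma> k"
    and conv: "\<And>t. t \<in> {0..T} \<Longrightarrow> (\<lambda>k. krov (\<nu> (\<sigma> k) (real (\<sigma> k) * t)) (\<mu> t)) \<longlonglongrightarrow> 0"
    using lim_point unfolding krov_limit_point_def by blast
  have "\<exists>P. network P \<and> (\<forall>t\<ge>0. \<nu> (\<sigma> k) t = distr (measure_pmf (P t)) borel (scaled (\<sigma> k)))" for k
    using assms(6)[OF \<sigma>(2)[of k]] \<sigma>(2)[of k] by (intro nlmp_evolution_network) simp_all
  then have "\<exists>R. \<forall>k. network (R k)
      \<and> (\<forall>t\<ge>0. \<nu> (\<sigma> k) t = distr (measure_pmf (R k t)) borel (scaled (\<sigma> k)))"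
    by (intro choice allI)
  then obtain R where R: "\<And>k. network (R k)"
    "\<And>k t. 0 \<le> t \<Longrightarrow> \<nu> (\<sigma> k) t = distr (measure_pmf (R k t)) borel (scaled (\<sigma> k))"
    by auto
  \<comment> \<open>Thinning again is harmless: convergence to \<open>\<mu>\<close> along
    \<open>\<sigma>\<close> is inherited by every further subsequence.\<close>
  obtain \<rho> Y where \<rho>: "strict_mono (\<rho> :: nat \<Rightarrow> nat)" and Y: "inflow_on T Y"
    and unif: "\<And>e. 0 < e \<Longrightarrow> \<forall>\<^sub>F j in sequentially. \<forall>a. \<forall>s\<in>{0..T}.
      \<bar>network.scaled_arrivals (R (\<rho> j)) (\<sigma> (\<rho> j)) a s - Y a s\<bar> \<le> e"
    using scaled_arrivals_subsequence[of R T \<sigma>, OF R(1) less_imp_le[OF \<open>T > 0\<close>]]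
    by (elim exE conjE) simp
  define N where "N = \<sigma> \<circ> \<rho>"
  define Q where "Q = R \<circ> \<rho>"
  have N: "strict_mono N" "\<And>j. 0 < N j"
    using \<sigma> \<rho> strict_mono_o[OF \<sigma>(1) \<rho>] unfolding N_def by (auto simp: Suc_le_eq)
  have net: "network (Q j)" for j using R by (simp add: Q_def)
  have \<nu>_eq: "\<nu> (N j) t = distr (measure_pmf (Q j t)) borel (scaled (N j))" if "0 \<le> t" for j t
    using R(2)[OF that] by (simp add: N_def Q_def)
  have krov_t: "(\<lambda>j. krov (distr (Q j (real (N j) * t)) borel (scaled (N j))) (\<mu> t)) \<longlonglongrightarrow> 0"
    if t: "t \<in> {0..T}" for t
  proof -
    have "(\<lambda>j. krov (\<nu> (N j) (real (N j) * t)) (\<mu> t)) \<longlonglongrightarrow> 0"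
      using LIMSEQ_subseq_LIMSEQ[OF conv[OF t] \<rho>] by (simp add: N_def o_def)
    then show ?thesis using t by (simp add: \<nu>_eq)
  qed
  have krov_0: "(\<lambda>j. krov (distr (Q j 0) borel (scaled (N j))) \<mu>\<^sub>0) \<longlonglongrightarrow> 0"
  proof -
    have "(\<lambda>j. krov (\<nu>\<^sub>0 (N j)) \<mu>\<^sub>0) \<longlonglongrightarrow> 0"
      using LIMSEQ_subseq_LIMSEQ[OF assms(5) N(1)] by (simp add: o_def)
    moreover have "\<nu>\<^sub>0 (N j) = distr (Q j 0) borel (scaled (N j))" for j
      using \<nu>_eq[of 0 j] assms(6)[of "N j"] N(2)[of j] by simp
    ultimately show ?thesis by simp
  qed
  have unif': "\<forall>\<^sub>F j in sequentially. \<forall>a. \<forall>s\<in>{0..T}.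
      \<bar>network.scaled_arrivals (Q j) (N j) a s - Y a s\<bar> \<le> e" if "0 < e" for e
    using unif[OF that] by (simp add: Q_def N_def)
  have T: "0 \<in> {0..T}" using \<open>T > 0\<close> by simp
  \<comment> \<open>A limit point brings its own value at time 0; it is a KROV limit of the same
    initial laws as \<open>\<mu>\<^sub>0\<close>, so both integrate bounded Lipschitz functions
    alike.\<close>
  have \<mu>_0: "\<mu> 0 = \<mu>\<^sub>0"
  proof (rule prob_measure_eqI_l1_lipschitz[OF \<mu>[OF T] \<mu>\<^sub>0])
    fix \<phi> :: "pt \<Rightarrow> real" and L
    assume \<phi>: "\<And>x. 0 \<le> \<phi> x" "\<And>x. \<phi> x \<le> 1" and lip: "\<And>x y. \<bar>\<phi> x - \<phi> y\<bar> \<le> L * l1_dist x y"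
    have "(\<lambda>j. integral\<^sup>L (distr (Q j 0) borel (scaled (N j))) \<phi>) \<longlonglongrightarrow> integral\<^sup>L (\<mu> 0) \<phi>"
      using krov_t[OF T] integrable_if_l1_lipschitz[OF \<mu>[OF T] lip \<phi>]
      by (intro krov_tendsto_integral(2)[OF _ lip]) simp_all
    moreover have "(\<lambda>j. integral\<^sup>L (distr (Q j 0) borel (scaled (N j))) \<phi>) \<longlonglongrightarrow> integral\<^sup>L \<mu>\<^sub>0 \<phi>"
      using krov_0 integrable_if_l1_lipschitz[OF \<mu>\<^sub>0 lip \<phi>]
      by (intro krov_tendsto_integral(2)[OF _ lip])
    ultimately have "integral\<^sup>L (\<mu> 0) \<phi> = integral\<^sup>L \<mu>\<^sub>0 \<phi>" by (rule LIMSEQ_unique)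
    then show "integral\<^sup>L (\<mu> 0) \<phi> \<le> integral\<^sup>L \<mu>\<^sub>0 \<phi>" by simp
  qed
  have \<mu>_t: "\<mu> t = distr (\<mu> 0) borel (fluid_flow Y t)" if t: "t \<in> {0..T}" for t
    unfolding \<mu>_0
    by (rule fluid_limit[OF filterlim_subseq[OF N(1)] N(2) net Y t unif' \<mu>\<^sub>0 \<mu>[OF t] krov_0 krov_t[OF t]])
  have int: "integrable (\<mu> t) (\<lambda>x. x $ a)" if "t \<in> {0..T}" for t a
    using finite_first_moment_component[OF moment[OF that] \<mu>(2)[OF that]] .
  have "fluid_trajectory T \<mu>"
    unfolding fluid_trajectory_def
  proof (intro conjI ballI exI[of _ Y] Y prob)
    fix t assume t: "t \<in> {0..T}"
    have A: "(\<lambda>j. network.scaled_arrivals (Q j) (N j) a t) \<longlonglongrightarrow> Y a t" for a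
    proof (rule LIMSEQ_I)
      fix e :: real assume "0 < e"
      have "\<forall>\<^sub>F j in sequentially. norm (network.scaled_arrivals (Q j) (N j) a t - Y a t) < e"
        using unif'[OF half_gt_zero[OF \<open>0 < e\<close>]]
      proof (rule eventually_mono)
        fix j assume "\<forall>a. \<forall>s\<in>{0..T}. \<bar>network.scaled_arrivals (Q j) (N j) a s - Y a s\<bar> \<le> e / 2"
        then have "\<bar>network.scaled_arrivals (Q j) (N j) a t - Y a t\<bar> \<le> e / 2" using t by blast
        then show "norm (network.scaled_arrivals (Q j) (N j) a t - Y a t) < e"
          using \<open>0 < e\<close> by simp
      qed
      then show "\<exists>n. \<forall>j\<ge>n. norm (network.scaled_arrivals (Q j) (N j) a t - Y a t) < e"
        by (simp add: eventually_sequentially)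
    qed
    define Z where "Z a = (\<integral>x. net_outflow Y t x a \<partial>\<mu> 0)" for a
    have outflow_int: "integrable (\<mu> 0) (\<lambda>x. net_outflow Y t x a)" for a
      by (rule integral_net_outflow(1)[OF Y t \<mu>[OF T] int[OF T] \<mu>_t[OF t] int[OF t]])
    have D: "(\<lambda>j. network.departures (Q j) a (real (N j) * t) / real (N j)) \<longlonglongrightarrow> Z a" for a
      unfolding Z_def integral_net_outflow(2)[OF Y t \<mu>[OF T] int[OF T] \<mu>_t[OF t] int[OF t]]
      using t by (intro departures_limit[OF N(2) net _ A int[OF T] int[OF t] krov_0[folded \<mu>_0] krov_t[OF t]]) simp
    \<comment> \<open>Dividing \<open>arrivals_balance\<close> by \<open>N j\<close> writes one real
      sequence in two ways. Each equation of the fluid model for \<open>Y\<close> is then uniqueness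
      of its limit.\<close>
    have bal: "network.scaled_arrivals (Q j) (N j) a t = (case a of
        K_O \<Rightarrow> network.departures (Q j) K_AB (real (N j) * t) / real (N j)
          + network.departures (Q j) K_BA (real (N j) * t) / real (N j)
      | K_A \<Rightarrow> network.departures (Q j) K_O (real (N j) * t) / real (N j) / 2
      | K_B \<Rightarrow> network.departures (Q j) K_O (real (N j) * t) / real (N j) / 2
      | K_AB \<Rightarrow> network.departures (Q j) K_A (real (N j) * t) / real (N j)
      | K_BA \<Rightarrow> network.departures (Q j) K_B (real (N j) * t) / real (N j))" for j a
    proof -
      have "0 \<le> real (N j) * t" using t by simp
      note bal = network.arrivals_balance[OF net this, of j]
      show ?thesis
        by (cases a) (simp_all add: network.scaled_arrivals_def[OF net] bal add_divide_distrib)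
    qed
    have "Y K_O t = Z K_AB + Z K_BA"
      using A[of K_O] tendsto_add[OF D[of K_AB] D[of K_BA]] unfolding bal cls.case by (rule LIMSEQ_unique)
    then show "Y K_O t = (\<integral>x. net_outflow Y t x K_AB + net_outflow Y t x K_BA \<partial>\<mu> 0)"
      using outflow_int by (simp add: Z_def)
    show "Y K_A t = (\<integral>x. net_outflow Y t x K_O \<partial>\<mu> 0) / 2"
      using A[of K_A] tendsto_divide[OF D[of K_O] tendsto_const, of 2]
      unfolding bal cls.case Z_def by (intro LIMSEQ_unique) auto
    show "Y K_B t = (\<integral>x. net_outflow Y t x K_O \<partial>\<mu> 0) / 2"
      using A[of K_B] tendsto_divide[OF D[of K_O] tendsto_const, of 2]
      unfolding bal cls.case Z_def by (intro LIMSEQ_unique) auto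
    show "Y K_AB t = (\<integral>x. net_outflow Y t x K_A \<partial>\<mu> 0)"
      using A[of K_AB] D[of K_A] unfolding bal cls.case Z_def by (rule LIMSEQ_unique)
    show "Y K_BA t = (\<integral>x. net_outflow Y t x K_B \<partial>\<mu> 0)"
      using A[of K_BA] D[of K_B] unfolding bal cls.case Z_def by (rule LIMSEQ_unique)
    show "\<mu> t = distr (\<mu> 0) borel (fluid_flow Y t)" by (rule \<mu>_t[OF t])
  qed
  with \<mu>_0 show "fluid_trajectory T \<mu> \<and> \<mu> 0 = \<mu>\<^sub>0" by simp
qed

end
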